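(* Let $d\ge1$, $p\ge2$, $1\le r\le p-1$ be integers, let $\sigma>0$, and let $c=\frac{1}{p-r+1}$. Let $\mathcal{F}_{p,d}$, $\mathcal{P}$, $\mathcal{G}_{p,d}$, $\mathcal{P}'$ and the excess risk $\tilde R$ be as defined in the context, so that $\mathcal{P}'\subseteq\mathcal{P}$. Put $$c_0:=\frac{1-\frac1{2^r}+c^{2d}\left(\frac1{2^r}-\frac1{2^{p-2}}\right)}{\sigma\sqrt{2\left[(d+1)\left(1-\frac1{2^r}\right)+\left(\frac{1-c^{2(d+1)}}{1-c^2}\right)\left(\frac{c^{2d}}{2^r}\right)\right]}},\qquad c_1:=\frac{1-\frac1{2^r}+\frac{c^{2d}}{2^r}}{\sigma\sqrt{2\left[(d+1)\left(1-\frac1{2^r}\right)+\left(\frac{1-c^{2(d+1)}}{1-c^2}\right)\left(\frac{c^{2d}}{2^r}\right)\right]}},$$ and $$\xi_2(\hat f,\mathbb{P}):=P_{(\tilde{\mathbf{W}}^*,S)\sim\mathbb{P}}\left(\tilde R(\hat f(S))\ge\frac{\mathrm{erf}(c_1)-\mathrm{erf}(c_0)}{2}\right).$$ If $$n\le\sigma^2\,\frac{\sum_{i=1}^{r}\log(i)+p\log(2)-\log(4)}{4},$$ then $$\inf_{\hat f\in\Psi(\mathcal{G}_{p,d})}\ \sup_{\mathbb{P}\in\mathcal{P}'}\ \xi_2(\hat f,\mathbb{P})\ \ge\ \frac12,$$ where $\Psi(\mathcal{G}_{p,d})$ is the set of all (measurable) decoders $\hat f:(\mathbb{R}^p\ti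mes\{-1,+1\})^n\to\mathcal{G}_{p,d}$.
   Context: **Parameters.** All layers have size $n_0=\dots=n_d=p$. $\mathcal{F}_{p,d}=\mathbb{R}^p\times(\mathbb{R}^{p\times p})^d$; its elements are written $\tilde{\mathbf{W}}=(\tilde{\mathbf{w}}_0,\tilde{\mathbf{W}}_1,\dots,\tilde{\mathbf{W}}_d)$ with $\tilde{\mathbf{w}}_0\in\mathbb{R}^p$, $\tilde{\mathbf{W}}_i\in\mathbb{R}^{p\times p}$. **Backwards networks and the family $\mathcal{P}$.** A $d$-layer backwards network with parameter $\tilde{\mathbf{W}}$ generates a label $y\in\{-1,+1\}$ first and then an input $\mathbf{x}\in\mathbb{R}^p$ through a Markov chain $y\mapsto\mathbf{z}_0\mapsto\mathbf{z}_1\mapsto\dots\mapsto\mathbf{z}_d=:\mathbf{x}$, where the conditional law of $\mathbf{z}_0$ given $y$ depends on $y$ only through $y\tilde{\mathbf{w}}_0$, and for $i\ge1$ the conditional law of $\mathbf{z}_i$ given the past depends only on $\tilde{\mathbf{W}}_i\phi(\mathbf{z}_{i-1})$, with $\phi:\mathbb{R}\to\mathbb{R}$ an activation function applied entrywise. $\mathcal{P}_{(\mathbf{x},y)|\tilde{\mathbf{W}}}$ is the collection of all laws of $(\mathbf{x},y)$ obtained in this way, over all activation functions and all choices of the distributions involved. $\mathcal{P}$ is the collection of all joint laws $\mathbb{P}(\tilde{\mathbf{W}},S)=\mathbb{P}(\tilde{\mathbf{W}})\,\mathbb{P}^n((\mathbf{x},y)|\tilde{\mathbf{W}})$, where $\mathbb{P}(\tilde{\mathbf{W}})$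 is any probability distribution on $\mathcal{F}_{p,d}$, $\mathbb{P}((\mathbf{x},y)|\tilde{\mathbf{W}})\in\mathcal{P}_{(\mathbf{x},y)|\tilde{\mathbf{W}}}$ for every $\tilde{\mathbf{W}}$, and $S=\{(\mathbf{x}_i,y_i)\}_{i=1}^n$ is i.i.d. given $\tilde{\mathbf{W}}$. **Gaussian backwards network (identity activation).** Given $\tilde{\mathbf{W}}\in\mathcal{F}_{p,d}$ and $\sigma>0$: $y\sim\mathrm{Uniform}\{-1,+1\}$, $\mathbf{z}_0|y\sim N(y\tilde{\mathbf{w}}_0,\sigma^2\mathbf{I}_p)$, $\mathbf{z}_i|\mathbf{z}_{i-1}\sim N(\tilde{\mathbf{W}}_i\mathbf{z}_{i-1},\sigma^2\mathbf{I}_p)$ for $1\le i\le d$ (a Markov chain), and $\mathbf{x}:=\mathbf{z}_d$. Its law of $(\mathbf{x},y)$ is denoted $\mathbb{P}_{(\mathbf{x},y);\tilde{\mathbf{W}}}$. **The class $\mathcal{G}_{p,d}$.** $\mathcal{G}_{p,d}$ is the set of $(\tilde{\mathbf{w}}_0,\tilde{\mathbf{W}}_1,\dots,\tilde{\mathbf{W}}_d)$ with $\tilde{\mathbf{w}}_0\in\mathcal{G}^{(0)}$ and $\tilde{\mathbf{W}}_i\in\mathcal{G}^{(i)}$, where for $1\le i\le d$ $$\mathcal{G}^{(i)}=\left\{\begin{bmatrix}\mathbf{R}&\mathbf{0}\\ \mathbf{0}&c\,\mathbf{I}_{p-r}\end{bmatrix}:\mathbf{R}\in\{0,1\}^{r\times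 r}\text{ a permutation matrix}\right\},$$ and $\mathcal{G}^{(0)}=\left\{\frac{\pm1}{\sqrt{2}}\right\}\times\left\{\frac{\pm1}{\sqrt{4}}\right\}\times\dots\times\left\{\frac{\pm1}{\sqrt{2^{p-2}}}\right\}\times\left\{\frac{\pm1}{\sqrt{2^{p-1}}}\right\}\times\left\{\frac{\pm1}{\sqrt{2^{p-1}}}\right\}\subset\mathbb{R}^p$. **$\mathcal{P}'$.** $\mathcal{P}'$ consists of the joint law of $(\tilde{\mathbf{W}}^*,S)$ with $\tilde{\mathbf{W}}^*\sim\mathrm{Uniform}(\mathcal{G}_{p,d})$ and, given $\tilde{\mathbf{W}}^*$, $S=\{(\mathbf{x}_i,y_i)\}_{i=1}^n$ i.i.d. from the Gaussian backwards network with parameter $\tilde{\mathbf{W}}^*$ and variance $\sigma^2$. **Risk.** $\boldsymbol{\mu}_{\mathbf{x}|y;\tilde{\mathbf{W}}}=\mathbb{E}_{\mathbf{x}|y;\tilde{\mathbf{W}}}[\mathbf{x}|y]$ is the conditional mean of $\mathbf{x}$ given $y$ in the network with parameter $\tilde{\mathbf{W}}$. The prediction risk of $\tilde{\mathbf{W}}$ with respect to the true parameter $\tilde{\mathbf{W}}^*$ is $R(\tilde{\mathbf{W}},\tilde{\mathbf{W}}^* ):=P_{(\mathbf{x},y);\tilde{\mathbf{W}}^*}\left[\mathbf{x}^\top\boldsymbol{\mu}_{\mathbf{x}|y;\tilde{\mathbf{W}}}\le0\right]$ and the excess risk is $\tilde R(\tilde{\mathbf{W}}):=R(\tilde{\mathbf{W}},\tilde{\mathbf{W}}^*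 )-R(\tilde{\mathbf{W}}^*,\tilde{\mathbf{W}}^* )$. $\mathrm{erf}$ is the Gauss error function; $\log$ is the natural logarithm. *)

theory Defs
  imports "HOL-Probability.Probability" "HOL-Combinatorics.Permutations"
begin

text \<open>
  Since the dimension \<open>p\<close> and the depth \<open>d\<close> are natural numbers, vectors in \<open>\<real>\<^sup>p\<close> and
  \<open>p \<times> p\<close> matrices are extensional functions on \<open>{1..p}\<close> and \<open>{1..p} \<times> {1..p}\<close>, with the
  product Borel sigma-algebra.  A parameter is a pair \<open>W\<close> with \<open>fst W\<close> the vector \<open>w\<^sub>0\<close> and
  \<open>snd W i\<close> the matrix \<open>W\<^sub>i\<close>, for \<open>i\<close> in \<open>{1..d}\<close>.
\<close>

type_synonym vec = "nat \<Rightarrow> real"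
type_synonym mat = "nat \<times> nat \<Rightarrow> real"
type_synonym param = "vec \<times> (nat \<Rightarrow> mat)"

definition vec_M :: "nat \<Rightarrow> vec measure" where
  "vec_M p = PiM {1..p} (\<lambda>_. borel)"

definition mat_M :: "nat \<Rightarrow> mat measure" where
  "mat_M p = PiM ({1..p} \<times> {1..p}) (\<lambda>_. borel)"

definition param_M :: "nat \<Rightarrow> nat \<Rightarrow> param measure" where
  "param_M p d = vec_M p \<Otimes>\<^sub>M PiM {1..d} (\<lambda>_. mat_M p)"

definition label_M :: "real measure" where
  "label_M = count_space {-1, 1}"

definition data_M :: "nat \<Rightarrow> (vec \<times> real) measure" where
  "data_M p = vec_M p \<Otimes>\<^sub>M label_M"

definition sample_M :: "nat \<Rightarrow> nat \<Rightarrow> (nat \<Rightarrow> vec \<times> real) measure" where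
  "sample_M p n = PiM {1..n} (\<lambda>_. data_M p)"

definition inner_vec :: "nat \<Rightarrow> vec \<Rightarrow> vec \<Rightarrow> real" where
  "inner_vec p u v = (\<Sum>j\<in>{1..p}. u j * v j)"

definition mat_vec :: "nat \<Rightarrow> mat \<Rightarrow> vec \<Rightarrow> vec" where
  "mat_vec p A v = (\<lambda>i\<in>{1..p}. \<Sum>j\<in>{1..p}. A (i, j) * v j)"

text \<open>
  Backwards networks.  The layers are given by probability kernels \<open>K 0, \<dots>, K d\<close>: given \<open>y\<close>, the
  law of \<open>z\<^sub>0\<close> is \<open>K 0 (y w\<^sub>0)\<close>, and given the past, the law of \<open>z\<^sub>i\<close> is
  \<open>K i (W\<^sub>i \<phi>(z\<^bsub>i-1\<^esub>))\<close>.  Then \<open>layer_law p K \<phi> W y i\<close> is the conditional law of \<open>z\<^sub>i\<close> given \<open>y\<close>,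
  obtained by integrating out the earlier layers.
\<close>

primrec layer_law ::
  "nat \<Rightarrow> (nat \<Rightarrow> vec \<Rightarrow> vec measure) \<Rightarrow> (real \<Rightarrow> real) \<Rightarrow> param \<Rightarrow> real \<Rightarrow> nat \<Rightarrow> vec measure"
where
  "layer_law p K \<phi> W y 0 = K 0 (\<lambda>j\<in>{1..p}. y * fst W j)"
| "layer_law p K \<phi> W y (Suc i) =
     layer_law p K \<phi> W y i \<bind>
       (\<lambda>z. K (Suc i) (mat_vec p (snd W (Suc i)) (\<lambda>j\<in>{1..p}. \<phi> (z j))))"

definition network_law ::
  "nat \<Rightarrow> nat \<Rightarrow> real measure \<Rightarrow> (nat \<Rightarrow> vec \<Rightarrow> vec measure) \<Rightarrow> (real \<Rightarrow> real) \<Rightarrow> param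
    \<Rightarrow> (vec \<times> real) measure" where
  "network_law p d Q K \<phi> W =
     Q \<bind> (\<lambda>y. distr (layer_law p K \<phi> W y d) (data_M p) (\<lambda>x. (x, y)))"

text \<open>The collection \<open>\<P>\<^bsub>(x,y)|W\<^esub>\<close>: the label law, kernels and activation are arbitrary and may
  depend on \<open>W\<close>.\<close>

definition network_laws :: "nat \<Rightarrow> nat \<Rightarrow> param \<Rightarrow> (vec \<times> real) measure set" where
  "network_laws p d W =
     {network_law p d Q K \<phi> W | Q K \<phi>.
        Q \<in> space (prob_algebra label_M) \<and>
        (\<forall>i\<le>d. K i \<in> vec_M p \<rightarrow>\<^sub>M prob_algebra (vec_M p)) \<and>
        \<phi> \<in> borel_measurable borel}"

definition joint_law ::
  "nat \<Rightarrow> nat \<Rightarrow> nat \<Rightarrow> param measure \<Rightarrow> (param \<Rightarrow> (vec \<times> real) measure)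
    \<Rightarrow> (param \<times> (nat \<Rightarrow> vec \<times> real)) measure" where
  "joint_law p d n prior \<kappa> =
     prior \<bind> (\<lambda>W. distr (PiM {1..n} (\<lambda>_. \<kappa> W)) (param_M p d \<Otimes>\<^sub>M sample_M p n) (\<lambda>S. (W, S)))"

text \<open>The family \<open>\<P>\<close>.\<close>

definition joint_laws :: "nat \<Rightarrow> nat \<Rightarrow> nat \<Rightarrow> (param \<times> (nat \<Rightarrow> vec \<times> real)) measure set" where
  "joint_laws p d n =
     {joint_law p d n prior \<kappa> | prior \<kappa>.
        prior \<in> space (prob_algebra (param_M p d)) \<and>
        \<kappa> \<in> param_M p d \<rightarrow>\<^sub>M prob_algebra (data_M p) \<and>
        (\<forall>W\<in>space (param_M p d). \<kappa> W \<in> network_laws p d W)}"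

text \<open>\<open>N(m, \<sigma>\<^sup>2 I\<^sub>p)\<close>: independent coordinates; \<^const>\<open>normal_density\<close> takes the standard deviation.\<close>

definition gauss :: "nat \<Rightarrow> real \<Rightarrow> vec \<Rightarrow> vec measure" where
  "gauss p \<sigma> m = PiM {1..p} (\<lambda>j. density lborel (normal_density (m j) \<sigma>))"

definition gauss_x_given_y :: "nat \<Rightarrow> nat \<Rightarrow> real \<Rightarrow> param \<Rightarrow> real \<Rightarrow> vec measure" where
  "gauss_x_given_y p d \<sigma> W y = layer_law p (\<lambda>_. gauss p \<sigma>) (\<lambda>t. t) W y d"

definition gauss_network :: "nat \<Rightarrow> nat \<Rightarrow> real \<Rightarrow> param \<Rightarrow> (vec \<times> real) measure" where
  "gauss_network p d \<sigma> W =
     network_law p d (uniform_count_measure {-1, 1}) (\<lambda>_. gauss p \<sigma>) (\<lambda>t. t) W"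

text \<open>The class \<open>\<G>\<^bsub>p,d\<^esub>\<close>.  Coordinate \<open>j < p\<close> of \<open>w\<^sub>0\<close> has modulus \<open>2 powr (-j/2)\<close>, and the
  last coordinate repeats the modulus of coordinate \<open>p - 1\<close>.\<close>

definition G_vec :: "nat \<Rightarrow> vec set" where
  "G_vec p = PiE {1..p} (\<lambda>j. {s / sqrt (2 ^ min j (p - 1)) | s. s \<in> {-1, 1}})"

definition G_mat :: "nat \<Rightarrow> nat \<Rightarrow> real \<Rightarrow> mat set" where
  "G_mat p r c =
     {(\<lambda>(i, j)\<in>{1..p} \<times> {1..p}.
         if i \<le> r \<and> j \<le> r then (if i = \<pi> j then 1 else 0)
         else if i = j then c else 0) | \<pi>. \<pi> permutes {1..r}}"

definition G_class :: "nat \<Rightarrow> nat \<Rightarrow> nat \<Rightarrow> real \<Rightarrow> param set" where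
  "G_class p d r c = G_vec p \<times> PiE {1..d} (\<lambda>_. G_mat p r c)"

text \<open>The subfamily \<open>\<P>'\<close>.\<close>

definition G_prior :: "nat \<Rightarrow> nat \<Rightarrow> nat \<Rightarrow> real \<Rightarrow> param measure" where
  "G_prior p d r c = distr (uniform_count_measure (G_class p d r c)) (param_M p d) (\<lambda>W. W)"

definition G_joint_laws ::
  "nat \<Rightarrow> nat \<Rightarrow> nat \<Rightarrow> real \<Rightarrow> real \<Rightarrow> nat \<Rightarrow> (param \<times> (nat \<Rightarrow> vec \<times> real)) measure set" where
  "G_joint_laws p d r c \<sigma> n = {joint_law p d n (G_prior p d r c) (gauss_network p d \<sigma>)}"

definition cond_mean :: "nat \<Rightarrow> nat \<Rightarrow> real \<Rightarrow> param \<Rightarrow> real \<Rightarrow> vec" where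
  "cond_mean p d \<sigma> W y = (\<lambda>j\<in>{1..p}. \<integral>x. x j \<partial>(gauss_x_given_y p d \<sigma> W y))"

definition risk :: "nat \<Rightarrow> nat \<Rightarrow> real \<Rightarrow> param \<Rightarrow> param \<Rightarrow> real" where
  "risk p d \<sigma> W W' =
     measure (gauss_network p d \<sigma> W')
       {(x, y) \<in> space (gauss_network p d \<sigma> W'). inner_vec p x (cond_mean p d \<sigma> W y) \<le> 0}"

definition excess_risk :: "nat \<Rightarrow> nat \<Rightarrow> real \<Rightarrow> param \<Rightarrow> param \<Rightarrow> real" where
  "excess_risk p d \<sigma> W W' = risk p d \<sigma> W W' - risk p d \<sigma> W' W'"

definition decoders ::
  "nat \<Rightarrow> nat \<Rightarrow> nat \<Rightarrow> param set \<Rightarrow> ((nat \<Rightarrow> vec \<times> real) \<Rightarrow> param) set" where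
  "decoders p d n G = {f \<in> sample_M p n \<rightarrow>\<^sub>M param_M p d. f ` space (sample_M p n) \<subseteq> G}"

definition erf :: "real \<Rightarrow> real" where
  "erf x = 2 / sqrt pi * (LBINT t=0..x. exp (- t\<^sup>2))"

definition xi2 ::
  "nat \<Rightarrow> nat \<Rightarrow> real \<Rightarrow> real \<Rightarrow> real \<Rightarrow> ((nat \<Rightarrow> vec \<times> real) \<Rightarrow> param)
    \<Rightarrow> (param \<times> (nat \<Rightarrow> vec \<times> real)) measure \<Rightarrow> real" where
  "xi2 p d \<sigma> c0 c1 f P =
     measure P {(W, S) \<in> space P. excess_risk p d \<sigma> (f S) W \<ge> (erf c1 - erf c0) / 2}"

end

theory Submission
  imports Defs
begin

text \<open>
  With identity activations the law of \<open>x\<close> given \<open>y\<close> is \<open>N(y \<mu>\<^sub>W, \<Sigma>)\<close> with a diagonal \<open>\<Sigma>\<close> that is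
  the same for all \<open>W\<close> in the class, because permutation matrices are orthogonal; \<open>\<mu>\<^sub>W\<close> consists of
  the entries of \<open>w\<^sub>0\<close> permuted by the product of the layers, the lower block being scaled by
  \<open>c\<^sup>d\<close>.  Hence the risk of \<open>V\<close> at the truth \<open>W\<close> is an error-function value of the inner product of
  \<open>\<mu>\<^sub>V\<close> and \<open>\<mu>\<^sub>W\<close>, and an excess risk below the threshold forces \<open>\<mu>\<^sub>V\<close> and \<open>\<mu>\<^sub>W\<close> to be close.

  Closeness does not force \<open>\<mu>\<^sub>V = \<mu>\<^sub>W\<close>: for \<open>d = 1\<close> and \<open>r = p - 1\<close> the means may differ by
  exchanging the two smallest entries of the upper block.  But it determines all signs and the
  position of all but the last four entries of the upper block, so a fraction of at most
  \<open>(min r 4)! / (2\<^sup>p r!)\<close> of the parameters is close to a given one.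

  In place of Fano's inequality, the probability that the decoder lands close to the truth is
  compared with the one under the pure noise law \<open>\<mu> = 0\<close>.  If \<open>\<kappa> = exp(n / (2 \<sigma>\<^sup>2))\<close>, which bounds
  the second moment of the likelihood ratio \<open>L\<close> of the sample, then \<open>L \<le> L\<^sup>2 / (4 \<kappa>) + \<kappa>\<close> gives the
  bound \<open>1 / 4 + \<kappa> (min r 4)! / (2\<^sup>p r!)\<close> on the average success probability.  The hypothesis on \<open>n\<close>
  says \<open>\<kappa>\<^sup>8 \<le> 2\<^sup>p r! / 4\<close>, which leaves room for the factor \<open>(min r 4)!\<close>.
\<close>

section \<open>Finite products of kernels\<close>

text \<open>On a box both measures give the same product of integrals, because the indicator of a
  box factors over the coordinates; boxes determine a sigma-finite product. Sigma-finiteness of the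
  densities is a hypothesis of its own, since \<open>f\<close> may take the value infinity.\<close>

lemma PiM_density:
  assumes I: "finite I" and M: "\<And>i. sigma_finite_measure (M i)"
    and D: "\<And>i. sigma_finite_measure (density (M i) (f i))"
    and f[measurable]: "\<And>i. f i \<in> borel_measurable (M i)"
  shows "PiM I (\<lambda>i. density (M i) (f i)) = density (PiM I M) (\<lambda>x. \<Prod>i\<in>I. f i (x i))"
proof -
  interpret M: product_sigma_finite M by (rule product_sigma_finite.intro) (rule M)
  interpret D: product_sigma_finite "\<lambda>i. density (M i) (f i)"
    by (rule product_sigma_finite.intro) (rule D)
  show ?thesis
  proof (rule D.PiM_eqI[symmetric])
    show "sets (density (PiM I M) (\<lambda>x. \<Prod>i\<in>I. f i (x i))) = sets (PiM I (\<lambda>i. density (M i) (f i)))"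
      by (simp cong: sets_PiM_cong)
  next
    fix A assume A: "\<And>i. i \<in> I \<Longrightarrow> A i \<in> sets (density (M i) (f i))"
    then have A'[measurable]: "\<And>i. i \<in> I \<Longrightarrow> A i \<in> sets (M i)" by simp
    have [measurable]: "Pi\<^sub>E I A \<in> sets (PiM I M)"
      using A' I by (intro sets_PiM_I_finite) auto
    have "emeasure (density (PiM I M) (\<lambda>x. \<Prod>i\<in>I. f i (x i))) (Pi\<^sub>E I A)
        = (\<integral>\<^sup>+x. (\<Prod>i\<in>I. f i (x i)) * indicator (Pi\<^sub>E I A) x \<partial>PiM I M)"
      using I by (intro emeasure_density) measurable
    also have "\<dots> = (\<integral>\<^sup>+x. (\<Prod>i\<in>I. f i (x i) * indicator (A i) (x i)) \<partial>PiM I M)"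
    proof (rule nn_integral_cong)
      fix x assume x: "x \<in> space (PiM I M)"
      have "indicator (Pi\<^sub>E I A) x = (\<Prod>i\<in>I. indicator (A i) (x i) :: ennreal)"
      proof (cases "x \<in> Pi\<^sub>E I A")
        case True
        then show ?thesis by (auto simp: indicator_def PiE_iff)
      next
        case False
        then obtain i where "i \<in> I" "x i \<notin> A i" using x by (auto simp: space_PiM PiE_iff)
        then show ?thesis using I False by (auto simp: indicator_def)
      qed
      then show "(\<Prod>i\<in>I. f i (x i)) * indicator (Pi\<^sub>E I A) x = (\<Prod>i\<in>I. f i (x i) * indicator (A i) (x i))"
        by (simp add: prod.distrib)
    qed
    also have "\<dots> = (\<Prod>i\<in>I. \<integral>\<^sup>+x. f i x * indicator (A i) x \<partial>M i)"
      using I by (intro M.product_nn_integral_prod) auto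
    also have "\<dots> = (\<Prod>i\<in>I. emeasure (density (M i) (f i)) (A i))"
      by (intro prod.cong refl emeasure_density[symmetric]) auto
    finally show "emeasure (density (PiM I M) (\<lambda>x. \<Prod>i\<in>I. f i (x i))) (Pi\<^sub>E I A)
        = (\<Prod>i\<in>I. emeasure (density (M i) (f i)) (A i))" .
  qed fact
qed

lemma emeasure_PiM_prob:
  assumes "finite I" "\<And>i. i \<in> I \<Longrightarrow> prob_space (M i)" "\<And>i. i \<in> I \<Longrightarrow> A i \<in> sets (M i)"
  shows "emeasure (PiM I M) (Pi\<^sub>E I A) = (\<Prod>i\<in>I. emeasure (M i) (A i))"
proof -
  \<comment> \<open>Indices outside \<open>I\<close> receive a one-point probability space, so that
    the locale for products of probability spaces, which speaks of all indices, applies.\<close>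
  let ?M = "\<lambda>i. if i \<in> I then M i else count_space {undefined}"
  interpret M': prob_space "?M i" for i
    using assms(2) by (cases "i \<in> I") (auto intro!: prob_spaceI)
  interpret product_prob_space ?M I by unfold_locales
  have "PiM I M = PiM I ?M" by (rule PiM_cong) auto
  then have "emeasure (PiM I M) (Pi\<^sub>E I A) = (\<Prod>i\<in>I. emeasure (?M i) (A i))"
    using assms by (simp add: emeasure_PiM)
  then show ?thesis by simp
qed

text \<open>Boxes form an intersection-stable generator of the product sigma-algebra, and the mass
  of a box is a finite product of masses that depend measurably on the argument of the
  kernels.\<close>

lemma measurable_PiM_kernel:
  assumes I: "finite I" and K: "\<And>i. i \<in> I \<Longrightarrow> K i \<in> M \<rightarrow>\<^sub>M prob_algebra (N i)"
  shows "(\<lambda>x. PiM I (\<lambda>i. K i x)) \<in> M \<rightarrow>\<^sub>M prob_algebra (PiM I N)"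
proof (rule measurable_prob_algebra_generated[OF sets_PiM Int_stable_prod_algebra prod_algebra_sets_into_space])
  have p: "prob_space (K i x)" and s: "sets (K i x) = sets (N i)" if "i \<in> I" "x \<in> space M" for i x
    using measurable_space[OF K that(2)] that by (auto simp: space_prob_algebra)
  fix x assume x: "x \<in> space M"
  show "prob_space (PiM I (\<lambda>i. K i x))" by (rule prob_space_PiM) (rule p[OF _ x])
  show "sets (PiM I (\<lambda>i. K i x)) = sets (PiM I N)" by (rule sets_PiM_cong) (auto simp: s x)
next
  fix A assume "A \<in> prod_algebra I N"
  then obtain X where A: "A = Pi\<^sub>E I X" "\<And>i. i \<in> I \<Longrightarrow> X i \<in> sets (N i)"
    using I by (auto simp: prod_algebra_eq_finite)
  have p: "prob_space (K i x)" and s: "sets (K i x) = sets (N i)" if "i \<in> I" "x \<in> space M" for i x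
    using measurable_space[OF K that(2)] that by (auto simp: space_prob_algebra)
  have "(\<lambda>x. \<Prod>i\<in>I. emeasure (K i x) (X i)) \<in> borel_measurable M"
  proof (rule borel_measurable_prod_ennreal)
    fix i assume "i \<in> I"
    then show "(\<lambda>x. emeasure (K i x) (X i)) \<in> borel_measurable M"
      using measurable_emeasure_kernel[OF measurable_prob_algebraD[OF K] A(2)] by simp
  qed
  also have "?this \<longleftrightarrow> (\<lambda>x. emeasure (PiM I (\<lambda>i. K i x)) A) \<in> borel_measurable M"
    unfolding A(1) by (intro measurable_cong emeasure_PiM_prob[symmetric] I) (auto simp: p s A)
  finally show "(\<lambda>x. emeasure (PiM I (\<lambda>i. K i x)) A) \<in> borel_measurable M" .
qed

text \<open>New coordinate \<open>j\<close> reads only the old coordinate \<open>\<rho> j\<close>.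
  As \<rho> is a permutation, no old coordinate is read twice, so independence survives one step of
  the chain. This keeps the layers of a network with block permutation matrices product
  laws.\<close>

lemma bind_PiM_kernel:
  assumes I: "finite I" and \<rho>: "\<rho> permutes I" and M: "\<And>i. prob_space (M i)"
    and K: "\<And>j. j \<in> I \<Longrightarrow> K j \<in> M (\<rho> j) \<rightarrow>\<^sub>M prob_algebra (N j)"
  shows "PiM I M \<bind> (\<lambda>z. PiM I (\<lambda>j. K j (z (\<rho> j)))) = PiM I (\<lambda>j. M (\<rho> j) \<bind> K j)"
proof -
  interpret M: prob_space "M i" for i by (rule M)
  interpret MP: product_prob_space M by standard
  have \<rho>I: "j \<in> I \<Longrightarrow> \<rho> j \<in> I" for j using permutes_in_image[OF \<rho>] by simp
  have \<rho>I': "j \<in> I \<Longrightarrow> inv \<rho> j \<in> I" for j using permutes_in_image[OF permutes_inv[OF \<rho>]] by simp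
  have MA: "M i \<in> space (prob_algebra (M i))" for i
    by (simp add: space_prob_algebra M)
  have PMA: "PiM I M \<in> space (prob_algebra (PiM I M))"
    by (simp add: space_prob_algebra prob_space_PiM M)
  have KK: "(\<lambda>z. PiM I (\<lambda>j. K j (z (\<rho> j)))) \<in> PiM I M \<rightarrow>\<^sub>M prob_algebra (PiM I N)"
    by (rule measurable_PiM_kernel[OF I], rule measurable_compose[OF _ K]) (auto simp: \<rho>I)
  have s: "sets (M (\<rho> j) \<bind> K j) = sets (N j)" if "j \<in> I" for j
    by (rule sets_bind'[OF MA K[OF that]])
  have p: "prob_space (M (\<rho> j) \<bind> K j)" if "j \<in> I" for j
    by (rule prob_space_bind'[OF MA K[OF that]])
  have sK: "sets (K j x) = sets (N j)" "prob_space (K j x)" if "j \<in> I" "x \<in> space (M (\<rho> j))" for j x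
    using measurable_space[OF K[OF that(1)] that(2)] by (auto simp: space_prob_algebra)
  have sB: "sets (PiM I M \<bind> (\<lambda>z. PiM I (\<lambda>j. K j (z (\<rho> j))))) = sets (PiM I N)"
    by (rule sets_bind'[OF PMA KK])
  show ?thesis
  proof (rule measure_eqI_PiM_infinite)
    show "sets (PiM I M \<bind> (\<lambda>z. PiM I (\<lambda>j. K j (z (\<rho> j))))) = sets (PiM I N)" by fact
    show "sets (PiM I (\<lambda>j. M (\<rho> j) \<bind> K j)) = sets (PiM I N)"
      by (rule sets_PiM_cong) (auto simp: s)
    show "finite_measure (PiM I M \<bind> (\<lambda>z. PiM I (\<lambda>j. K j (z (\<rho> j)))))"
      using prob_space_bind'[OF PMA KK] by (rule prob_space.finite_measure)
  next
    fix A0 J assume J: "finite J" "J \<subseteq> I" and A0: "\<And>i. i \<in> J \<Longrightarrow> A0 i \<in> sets (N i)"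
    define A where "A i = (if i \<in> J then A0 i else space (N i))" for i
    have A: "A i \<in> sets (N i)" for i using A0 by (auto simp: A_def)
    have eq: "prod_emb I N J (Pi\<^sub>E J A0) = Pi\<^sub>E I A"
      unfolding A_def using J A0[THEN sets.sets_into_space] by (intro prod_emb_PiE) auto
    have "emeasure (PiM I M \<bind> (\<lambda>z. PiM I (\<lambda>j. K j (z (\<rho> j))))) (Pi\<^sub>E I A)
      = (\<integral>\<^sup>+z. emeasure (PiM I (\<lambda>j. K j (z (\<rho> j)))) (Pi\<^sub>E I A) \<partial>PiM I M)"
      using I A by (intro emeasure_bind_prob_algebra[OF PMA KK] sets_PiM_I_finite) auto
    also have "\<dots> = (\<integral>\<^sup>+z. (\<Prod>j\<in>I. emeasure (K j (z (\<rho> j))) (A j)) \<partial>PiM I M)"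
    proof (intro nn_integral_cong emeasure_PiM_prob I)
      fix z j assume "z \<in> space (PiM I M)" "j \<in> I"
      then have "z (\<rho> j) \<in> space (M (\<rho> j))" by (auto simp: space_PiM PiE_iff \<rho>I)
      then show "prob_space (K j (z (\<rho> j)))" "A j \<in> sets (K j (z (\<rho> j)))"
        using sK[OF \<open>j \<in> I\<close>] A by auto
    qed
    \<comment> \<open>Indexing by the coordinate that is read makes each factor a function of a
      single \<open>z i\<close>, so that the integral of the product splits.\<close>
    also have "\<dots> = (\<integral>\<^sup>+z. (\<Prod>i\<in>I. emeasure (K (inv \<rho> i) (z i)) (A (inv \<rho> i))) \<partial>PiM I M)"
    proof (intro nn_integral_cong)
      fix z
      show "(\<Prod>j\<in>I. emeasure (K j (z (\<rho> j))) (A j)) = (\<Prod>i\<in>I. emeasure (K (inv \<rho> i) (z i)) (A (inv \<rho> i)))"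
        using prod.permute[OF \<rho>, of "\<lambda>i. emeasure (K (inv \<rho> i) (z i)) (A (inv \<rho> i))"]
        by (simp add: o_def permutes_inverses[OF \<rho>])
    qed
    also have "\<dots> = (\<Prod>i\<in>I. \<integral>\<^sup>+x. emeasure (K (inv \<rho> i) x) (A (inv \<rho> i)) \<partial>M i)"
    proof (rule MP.product_nn_integral_prod[OF I])
      fix i assume i: "i \<in> I"
      show "(\<lambda>x. emeasure (K (inv \<rho> i) x) (A (inv \<rho> i))) \<in> borel_measurable (M i)"
        using measurable_emeasure_kernel[OF measurable_prob_algebraD[OF K[OF \<rho>I'[OF i]]] A]
        by (simp add: permutes_inverses[OF \<rho>])
    qed
    also have "\<dots> = (\<Prod>j\<in>I. \<integral>\<^sup>+x. emeasure (K j x) (A j) \<partial>M (\<rho> j))"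
      using prod.permute[OF \<rho>, of "\<lambda>i. \<integral>\<^sup>+x. emeasure (K (inv \<rho> i) x) (A (inv \<rho> i)) \<partial>M i"]
      by (simp add: o_def permutes_inverses[OF \<rho>])
    also have "\<dots> = (\<Prod>j\<in>I. emeasure (M (\<rho> j) \<bind> K j) (A j))"
      using A by (intro prod.cong refl emeasure_bind_prob_algebra[OF MA K, symmetric]) auto
    also have "\<dots> = emeasure (PiM I (\<lambda>j. M (\<rho> j) \<bind> K j)) (Pi\<^sub>E I A)"
      using A by (intro emeasure_PiM_prob[symmetric] I p) (auto simp: s)
    finally show "emeasure (PiM I M \<bind> (\<lambda>z. PiM I (\<lambda>j. K j (z (\<rho> j))))) (prod_emb I N J (Pi\<^sub>E J A0))
      = emeasure (PiM I (\<lambda>j. M (\<rho> j) \<bind> K j)) (prod_emb I N J (Pi\<^sub>E J A0))"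
      unfolding eq .
  qed
qed

section \<open>Normal laws and the error function\<close>

definition normal_law :: "real \<Rightarrow> real \<Rightarrow> real measure" where
  "normal_law m s = density lborel (normal_density m s)"

lemma sets_normal_law [simp, measurable_cong]: "sets (normal_law m s) = sets borel"
  by (simp add: normal_law_def)

lemma space_normal_law [simp]: "space (normal_law m s) = UNIV"
  by (simp add: normal_law_def)

lemma prob_space_normal_law: "s > 0 \<Longrightarrow> prob_space (normal_law m s)"
  unfolding normal_law_def by (rule prob_space_normal_density)

lemma normal_law_in_prob_algebra: "s > 0 \<Longrightarrow> normal_law m s \<in> space (prob_algebra borel)"
  by (simp add: space_prob_algebra prob_space_normal_law)

lemma distr_normal_law_affine:
  assumes "s > 0" "a \<noteq> 0"
  shows "distr (normal_law m s) borel (\<lambda>x. b + a * x) = normal_law (b + a * m) (\<bar>a\<bar> * s)"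
proof -
  interpret prob_space "normal_law m s" by (rule prob_space_normal_law) fact
  have "distributed (normal_law m s) lborel (\<lambda>x. x) (normal_density m s)"
    by (auto simp: distributed_def normal_law_def intro!: measure_eqI simp: emeasure_distr)
  from normal_density_affine[OF this assms, of b]
  have "distr (normal_law m s) lborel (\<lambda>x. b + a * x) = normal_law (b + a * m) (\<bar>a\<bar> * s)"
    by (simp add: distributed_def normal_law_def)
  moreover have "distr (normal_law m s) borel (\<lambda>x. b + a * x) = distr (normal_law m s) lborel (\<lambda>x. b + a * x)"
    by (rule distr_cong) auto
  ultimately show ?thesis by simp
qed

text \<open>The law with mean \<open>m\<close> is the translate by \<open>m\<close> of the centred
  one, and an image measure depends measurably on a parameter of the map.\<close>

lemma measurable_normal_law:
  assumes "s > 0"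
  shows "(\<lambda>m. normal_law m s) \<in> borel \<rightarrow>\<^sub>M prob_algebra borel"
proof (rule measurable_prob_algebraI)
  show "prob_space (normal_law m s)" for m by (rule prob_space_normal_law) fact
  have "(\<lambda>m. distr (normal_law 0 s) borel (\<lambda>x. m + x)) \<in> borel \<rightarrow>\<^sub>M subprob_algebra borel"
  proof (rule measurable_distr2[where M=borel])
    show "(\<lambda>m. normal_law 0 s) \<in> borel \<rightarrow>\<^sub>M subprob_algebra borel"
      using assms by (intro measurable_const)
        (simp add: space_subprob_algebra prob_space_normal_law prob_space_imp_subprob_space)
  qed simp
  also have "(\<lambda>m. distr (normal_law 0 s) borel (\<lambda>x. m + x)) = (\<lambda>m. normal_law m s)"
    using distr_normal_law_affine[OF assms, of 1 0] by (simp add: fun_eq_iff)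
  finally show "(\<lambda>m. normal_law m s) \<in> borel \<rightarrow>\<^sub>M subprob_algebra borel" .
qed

text \<open>Once the factor \<open>a\<close> is absorbed into the law of \<open>z\<close>, this is
  the addition of variances under convolution. It describes the effect of one layer on one
  coordinate, with \<open>a\<close> equal to 1 in the upper block and to \<open>c\<close> in the
  lower one.\<close>

lemma bind_normal_law:
  assumes t: "t > 0" and s: "s > 0" and a: "a \<noteq> 0"
  shows "normal_law m t \<bind> (\<lambda>z. normal_law (a * z) s) = normal_law (a * m) (sqrt (a\<^sup>2 * t\<^sup>2 + s\<^sup>2))"
proof -
  define t' where "t' = \<bar>a\<bar> * t"
  have t': "t' > 0" using t a by (simp add: t'_def)
  define m' where "m' = a * m"
  have "normal_law m t \<bind> (\<lambda>z. normal_law (a * z) s) = distr (normal_law m t) borel (\<lambda>x. 0 + a * x) \<bind> (\<lambda>z. normal_law z s)"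
    using measurable_prob_algebraD[OF measurable_normal_law[OF s]]
    by (subst bind_distr[where K=borel]) auto
  also have "\<dots> = normal_law m' t' \<bind> (\<lambda>z. normal_law z s)"
    by (subst distr_normal_law_affine[OF t a]) (simp add: m'_def t'_def)
  also have "\<dots> = normal_law m' (sqrt (t'\<^sup>2 + s\<^sup>2))"
  proof (rule measure_eqI)
    note K = normal_law_in_prob_algebra[OF t'] measurable_normal_law[OF s]
    have sb: "sets (normal_law m' t' \<bind> (\<lambda>z. normal_law z s)) = sets borel"
      by (rule sets_bind'[OF K])
    then show "sets (normal_law m' t' \<bind> (\<lambda>z. normal_law z s)) = sets (normal_law m' (sqrt (t'\<^sup>2 + s\<^sup>2)))"
      by simp
    fix A assume "A \<in> sets (normal_law m' t' \<bind> (\<lambda>z. normal_law z s))"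
    then have A[measurable]: "A \<in> sets borel" by (simp add: sb)
    have [measurable]: "(\<lambda>(u, x). normal_density u s x) \<in> borel_measurable (borel \<Otimes>\<^sub>M borel)"
      unfolding normal_density_def by measurable
    have "emeasure (normal_law m' t' \<bind> (\<lambda>z. normal_law z s)) A
       = (\<integral>\<^sup>+u. emeasure (normal_law u s) A \<partial>normal_law m' t')"
      by (rule emeasure_bind_prob_algebra[OF K A])
    also have "\<dots> = (\<integral>\<^sup>+u. (\<integral>\<^sup>+x. ennreal (normal_density u s x) * indicator A x \<partial>lborel) \<partial>normal_law m' t')"
      by (simp add: normal_law_def emeasure_density)
    also have "\<dots> = (\<integral>\<^sup>+u. ennreal (normal_density m' t' u) * (\<integral>\<^sup>+x. ennreal (normal_density u s x) * indicator A x \<partial>lborel) \<partial>lborel)"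
      unfolding normal_law_def by (subst nn_integral_density) auto
    also have "\<dots> = (\<integral>\<^sup>+u. (\<integral>\<^sup>+x. ennreal (normal_density m' t' u) * (ennreal (normal_density u s x) * indicator A x) \<partial>lborel) \<partial>lborel)"
      by (simp add: nn_integral_cmult)
    also have "\<dots> = (\<integral>\<^sup>+x. (\<integral>\<^sup>+u. ennreal (normal_density m' t' u) * (ennreal (normal_density u s x) * indicator A x) \<partial>lborel) \<partial>lborel)"
      by (rule lborel_pair.Fubini'[symmetric]) measurable
    also have "\<dots> = (\<integral>\<^sup>+x. ennreal (normal_density m' (sqrt (t'\<^sup>2 + s\<^sup>2)) x) * indicator A x \<partial>lborel)"
    proof (rule nn_integral_cong)
      fix x :: real
      have "(\<integral>\<^sup>+u. ennreal (normal_density m' t' u) * (ennreal (normal_density u s x) * indicator A x) \<partial>lborel)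
        = (\<integral>\<^sup>+u. ennreal (normal_density m' t' u * normal_density u s x) * indicator A x \<partial>lborel)"
        by (simp add: ennreal_mult' mult.assoc)
      also have "\<dots> = (\<integral>\<^sup>+u. ennreal (normal_density m' t' u * normal_density u s x) \<partial>lborel) * indicator A x"
        by (rule nn_integral_multc) measurable
      \<comment> \<open>Translating the variable by \<open>m'\<close> brings the integrand to the
        convolution of two centred densities.\<close>
      also have "(\<integral>\<^sup>+u. ennreal (normal_density m' t' u * normal_density u s x) \<partial>lborel)
        = (\<integral>\<^sup>+v. ennreal (normal_density m' t' (m' + 1 * v) * normal_density (m' + 1 * v) s x) \<partial>lborel)"
        by (subst nn_integral_real_affine[where t=m' and c=1]) auto
      also have "\<dots> = (\<integral>\<^sup>+v. ennreal (normal_density 0 s ((x - m') - v) * normal_density 0 t' v) \<partial>lborel)"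
        by (intro nn_integral_cong) (simp add: normal_density_def algebra_simps)
      also have "\<dots> = normal_density 0 (sqrt (s\<^sup>2 + t'\<^sup>2)) (x - m')"
        using conv_normal_density_zero_mean[OF s t', THEN fun_cong, of "x - m'"] by simp
      also have "\<dots> = normal_density m' (sqrt (t'\<^sup>2 + s\<^sup>2)) x"
        by (simp add: normal_density_def add.commute)
      finally show "(\<integral>\<^sup>+u. ennreal (normal_density m' t' u) * (ennreal (normal_density u s x) * indicator A x) \<partial>lborel)
        = ennreal (normal_density m' (sqrt (t'\<^sup>2 + s\<^sup>2)) x) * indicator A x" .
    qed
    also have "\<dots> = emeasure (normal_law m' (sqrt (t'\<^sup>2 + s\<^sup>2))) A"
      by (simp add: normal_law_def emeasure_density)
    finally show "emeasure (normal_law m' t' \<bind> (\<lambda>z. normal_law z s)) A = emeasure (normal_law m' (sqrt (t'\<^sup>2 + s\<^sup>2))) A" .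
  qed
  finally show ?thesis by (simp add: m'_def t'_def power_mult_distrib)
qed

section \<open>Likelihood ratios of normal laws against the centred law\<close>

definition normal_likelihood_ratio :: "real \<Rightarrow> real \<Rightarrow> real \<Rightarrow> real" where
  "normal_likelihood_ratio m s x = exp ((2 * x * m - m\<^sup>2) / (2 * s\<^sup>2))"

lemma measurable_normal_likelihood_ratio [measurable]: "normal_likelihood_ratio m s \<in> borel_measurable borel"
  unfolding normal_likelihood_ratio_def by measurable

lemma normal_likelihood_ratio_pos: "normal_likelihood_ratio m s x > 0"
  by (simp add: normal_likelihood_ratio_def)

lemma density_normal_law:
  assumes "s > 0"
  shows "density (normal_law 0 s) (normal_likelihood_ratio m s) = normal_law m s"
proof -
  have "normal_density 0 s x * normal_likelihood_ratio m s x = normal_density m s x" for x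
    using assms by (simp add: normal_density_def normal_likelihood_ratio_def mult_exp_exp)
      (simp add: field_simps power2_eq_square)
  then show ?thesis
    unfolding normal_law_def by (subst density_density_eq) (auto simp: ennreal_mult'[symmetric])
qed

text \<open>Completing the square: the centred density times the squared ratio is
  \<open>exp (m\<^sup>2 / s\<^sup>2)\<close> times the normal density with mean
  \<open>2 * m\<close>, which has total mass 1.\<close>

lemma nn_integral_normal_likelihood_ratio_square:
  assumes "s > 0"
  shows "(\<integral>\<^sup>+x. (ennreal (normal_likelihood_ratio m s x))\<^sup>2 \<partial>normal_law 0 s) = ennreal (exp (m\<^sup>2 / s\<^sup>2))"
proof -
  interpret prob_space "normal_law (2 * m) s" by (rule prob_space_normal_law) fact
  have eq: "normal_density 0 s x * (normal_likelihood_ratio m s x)\<^sup>2 = exp (m\<^sup>2 / s\<^sup>2) * normal_density (2 * m) s x" for x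
    using assms by (simp add: normal_density_def normal_likelihood_ratio_def mult_exp_exp exp_double[symmetric])
      (simp add: field_simps power2_eq_square)
  have "(\<integral>\<^sup>+x. (ennreal (normal_likelihood_ratio m s x))\<^sup>2 \<partial>normal_law 0 s)
    = (\<integral>\<^sup>+x. ennreal (exp (m\<^sup>2 / s\<^sup>2) * normal_density (2 * m) s x) \<partial>lborel)"
    unfolding normal_law_def
    by (subst nn_integral_density)
      (auto simp: eq ennreal_mult'[symmetric] ennreal_power normal_likelihood_ratio_pos[THEN less_imp_le])
  also have "\<dots> = ennreal (exp (m\<^sup>2 / s\<^sup>2)) * emeasure (normal_law (2 * m) s) (space (normal_law (2 * m) s))"
    by (simp add: ennreal_mult' nn_integral_cmult normal_law_def emeasure_density)
  finally show ?thesis by (simp only: emeasure_space_1 mult_1_right)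
qed

text \<open>The function \<open>exp (- t\<^sup>2) / sqrt pi\<close> is the centred normal density
  with standard deviation \<open>1 / sqrt 2\<close>, and by symmetry half of its mass lies above 0.
  The tail form gives monotonicity at once and suits risks, which are probabilities of
  half-lines.\<close>

lemma erf_eq_normal_tail: "erf a = 1 - 2 * measure (normal_law 0 (1 / sqrt 2)) {a..}"
proof -
  define f where "f = normal_density 0 (1 / sqrt 2)"
  have f: "f x = 1 / sqrt pi * exp (- x\<^sup>2)" for x
    by (simp add: f_def normal_density_def real_sqrt_mult power_divide)
  have fi: "integrable lborel f" unfolding f_def by (rule integrable_normal_density) simp
  have ii: "interval_lebesgue_integrable lborel u v f" for u v
    unfolding interval_lebesgue_integrable_def set_integrable_def
    using integrable_mult_indicator[OF _ fi] by auto
  have sym: "(LBINT x=u..v. f x) = (LBINT x=-v..-u. f x)" for u v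
    using interval_integral_reflect[of u v f] by (simp add: f)
  have tot: "(LBINT x=-\<infinity>..\<infinity>. f x) = 1"
    unfolding f_def by (simp add: interval_lebesgue_integral_def set_lebesgue_integral_def einterval_def)
  have "(LBINT x=-\<infinity>..0. f x) + (LBINT x=0..\<infinity>. f x) = 1"
    using tot interval_integral_sum[of "-\<infinity>" 0 \<infinity> f] ii by simp
  moreover have "(LBINT x=-\<infinity>..0. f x) = (LBINT x=0..\<infinity>. f x)"
    using sym[of "-\<infinity>" 0] by simp
  ultimately have half: "(LBINT x=0..\<infinity>. f x) = 1 / 2" by simp
  have "(LBINT x=0..ereal a. f x) + (LBINT x=ereal a..\<infinity>. f x) = 1 / 2"
    using half interval_integral_sum[of 0 "ereal a" \<infinity> f] ii by simp
  moreover have "(LBINT x=0..ereal a. f x) = erf a / 2"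
    by (simp add: f erf_def)
  moreover have "(LBINT x=ereal a..\<infinity>. f x) = measure (normal_law 0 (1 / sqrt 2)) {a..}"
  proof -
    interpret prob_space "normal_law 0 (1 / sqrt 2)" by (rule prob_space_normal_law) simp
    have "ennreal (measure (normal_law 0 (1 / sqrt 2)) {a..}) = emeasure (normal_law 0 (1 / sqrt 2)) {a..}"
      by (simp add: emeasure_eq_measure)
    also have "\<dots> = (\<integral>\<^sup>+x. ennreal (f x) * indicator {a..} x \<partial>lborel)"
      by (simp add: normal_law_def f_def emeasure_density)
    also have "\<dots> = (\<integral>\<^sup>+x. ennreal (indicator {a<..} x * f x) \<partial>lborel)"
      \<comment> \<open>The interval integral up to infinity is taken over the open half-line; the
        endpoint is a null set.\<close>
      by (rule nn_integral_cong_AE, rule AE_mp[OF AE_lborel_singleton[of a]])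
        (auto simp: indicator_def)
    also have "\<dots> = ennreal (\<integral>x. indicator {a<..} x * f x \<partial>lborel)"
    proof (rule nn_integral_eq_integral)
      show "integrable lborel (\<lambda>x. indicator {a<..} x * f x)"
        using integrable_mult_indicator[OF _ fi, of "{a<..}"] by simp
      show "AE x in lborel. 0 \<le> indicator {a<..} x * f x" by (simp add: f_def)
    qed
    also have "(\<integral>x. indicator {a<..} x * f x \<partial>lborel) = (LBINT x=ereal a..\<infinity>. f x)"
      by (simp add: interval_integral_to_infinity_eq set_lebesgue_integral_def)
    finally show ?thesis
      by (subst (asm) ennreal_inj)
        (auto simp: interval_integral_to_infinity_eq set_lebesgue_integral_def f_def intro!: Bochner_Integration.integral_nonneg)
  qed
  ultimately show ?thesis by simp
qed

lemma erf_mono: "a \<le> b \<Longrightarrow> erf a \<le> erf b"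
proof -
  interpret prob_space "normal_law 0 (1 / sqrt 2)" by (rule prob_space_normal_law) simp
  assume "a \<le> b"
  then have "measure (normal_law 0 (1 / sqrt 2)) {b..} \<le> measure (normal_law 0 (1 / sqrt 2)) {a..}"
    by (intro finite_measure_mono) auto
  then show ?thesis by (simp add: erf_eq_normal_tail)
qed

lemma measure_normal_law_nonpos:
  assumes "v > 0"
  shows "measure (normal_law m v) {..0} = (1 - erf (m / (sqrt 2 * v))) / 2"
proof -
  \<comment> \<open>The scaling is negative so that \<open>{..0}\<close> pulls back to an upper
    tail.\<close>
  have "normal_law m v = distr (normal_law 0 (1 / sqrt 2)) borel (\<lambda>x. m + (- sqrt 2 * v) * x)"
    using assms by (subst distr_normal_law_affine) auto
  then have "measure (normal_law m v) {..0} =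
    measure (normal_law 0 (1 / sqrt 2)) ((\<lambda>x. m + (- sqrt 2 * v) * x) -` {..0} \<inter> space (normal_law 0 (1 / sqrt 2)))"
    by (simp add: measure_distr)
  also have "(\<lambda>x. m + (- sqrt 2 * v) * x) -` {..0} \<inter> space (normal_law 0 (1 / sqrt 2)) = {m / (sqrt 2 * v)..}"
    using assms by (auto simp: field_simps)
  finally show ?thesis by (simp add: erf_eq_normal_tail)
qed

text \<open>The coordinates are independent under a product law, and sums of independent normal
  variables are normal. Nonzero weights keep each summand from degenerating to a constant.\<close>

lemma distr_PiM_normal_law_inner:
  assumes I: "finite I" "I \<noteq> {}" and s: "\<And>i. s i > 0" and a: "\<And>i. i \<in> I \<Longrightarrow> a i \<noteq> 0"
  shows "distr (PiM I (\<lambda>i. normal_law (m i) (s i))) borel (\<lambda>x. \<Sum>i\<in>I. a i * x i)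
    = normal_law (\<Sum>i\<in>I. a i * m i) (sqrt (\<Sum>i\<in>I. (a i)\<^sup>2 * (s i)\<^sup>2))"
proof -
  let ?M = "\<lambda>i. normal_law (m i) (s i)" let ?P = "PiM I ?M"
  have p: "prob_space (?M i)" for i by (rule prob_space_normal_law) (rule s)
  interpret P: prob_space ?P by (rule prob_space_PiM) (rule p)
  have comp: "distr ?P borel (\<lambda>x. x i) = ?M i" if "i \<in> I" for i
  proof -
    have "distr ?P borel (\<lambda>x. x i) = distr ?P (?M i) (\<lambda>x. x i)" by (rule distr_cong) auto
    then show ?thesis using distr_PiM_component[of I ?M i] p that by simp
  qed
  have d: "distributed ?P lborel (\<lambda>x. 0 + a i * x i) (normal_density (0 + a i * m i) (\<bar>a i\<bar> * s i))" if "i \<in> I" for i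
  proof (rule P.normal_density_affine)
    have "distr ?P lborel (\<lambda>x. x i) = distr ?P borel (\<lambda>x. x i)" by (rule distr_cong) auto
    then show "distributed ?P lborel (\<lambda>x. x i) (normal_density (m i) (s i))"
      using that comp[OF that] by (auto simp: distributed_def normal_law_def)
  qed (use s a that in auto)
  have "P.indep_vars (\<lambda>i. borel) (\<lambda>i x. x i) I"
  proof (subst P.indep_vars_iff_distr_eq_PiM')
    have "distr ?P (PiM I (\<lambda>i. borel)) (\<lambda>x. \<lambda>i\<in>I. x i) = distr ?P ?P (\<lambda>x. x)"
      by (rule distr_cong) (auto cong: sets_PiM_cong simp: space_PiM)
    also have "\<dots> = ?P" by simp
    also have "?P = PiM I (\<lambda>i. distr ?P borel (\<lambda>x. x i))"
      by (rule PiM_cong) (simp_all add: comp)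
    finally show "distr ?P (PiM I (\<lambda>i. borel)) (\<lambda>x. \<lambda>i\<in>I. x i) = PiM I (\<lambda>i. distr ?P borel (\<lambda>x. x i))" .
  qed (use I in auto)
  then have ind: "P.indep_vars (\<lambda>i. borel) (\<lambda>i x. 0 + a i * x i) I"
    by (rule P.indep_vars_compose2) auto
  have "distributed ?P lborel (\<lambda>x. \<Sum>i\<in>I. 0 + a i * x i)
    (normal_density (\<Sum>i\<in>I. 0 + a i * m i) (sqrt (\<Sum>i\<in>I. (\<bar>a i\<bar> * s i)\<^sup>2)))"
    by (rule P.sum_indep_normal[OF I ind _ d]) (use s a in auto)
  then have "distr ?P lborel (\<lambda>x. \<Sum>i\<in>I. a i * x i) = normal_law (\<Sum>i\<in>I. a i * m i) (sqrt (\<Sum>i\<in>I. (a i)\<^sup>2 * (s i)\<^sup>2))"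
    by (simp add: distributed_def normal_law_def power_mult_distrib)
  moreover have "distr ?P lborel (\<lambda>x. \<Sum>i\<in>I. a i * x i) = distr ?P borel (\<lambda>x. \<Sum>i\<in>I. a i * x i)"
    by (rule distr_cong) auto
  ultimately show ?thesis by simp
qed

section \<open>Measurability of Gaussian backwards networks\<close>

lemma gauss_eq: "gauss p \<sigma> m = PiM {1..p} (\<lambda>j. normal_law (m j) \<sigma>)"
  by (simp add: gauss_def normal_law_def)

lemma space_label_M [simp]: "space label_M = {-1, 1}"
  by (simp add: label_M_def)

lemma measurable_label_M: "f \<in> label_M \<rightarrow>\<^sub>M borel"
  by (simp add: label_M_def)

lemma measurable_gauss:
  assumes "\<sigma> > 0"
  shows "gauss p \<sigma> \<in> vec_M p \<rightarrow>\<^sub>M prob_algebra (vec_M p)"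
  unfolding gauss_eq vec_M_def
proof (rule measurable_PiM_kernel)
  fix j assume "j \<in> {1..p}"
  then show "(\<lambda>m. normal_law (m j) \<sigma>) \<in> PiM {1..p} (\<lambda>_. borel) \<rightarrow>\<^sub>M prob_algebra borel"
    by (intro measurable_compose[OF _ measurable_normal_law[OF assms]]) simp
qed simp

lemma measurable_param_fst:
  assumes "j \<in> {1..p}"
  shows "(\<lambda>W. fst W j) \<in> borel_measurable (param_M p d)"
  unfolding param_M_def vec_M_def
  by (rule measurable_compose[OF measurable_fst measurable_component_singleton[OF assms]])

lemma measurable_param_snd:
  assumes "i \<in> {1..d}" "j \<in> {1..p}" "k \<in> {1..p}"
  shows "(\<lambda>W. snd W i (j, k)) \<in> borel_measurable (param_M p d)"
proof -
  have "(\<lambda>W. snd W i) \<in> param_M p d \<rightarrow>\<^sub>M mat_M p"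
    unfolding param_M_def by (rule measurable_compose[OF measurable_snd measurable_component_singleton[OF assms(1)]])
  then show ?thesis
    unfolding mat_M_def
    by (rule measurable_compose[OF _ measurable_component_singleton]) (use assms in auto)
qed

lemma measurable_vec_component:
  assumes "j \<in> {1..p}"
  shows "(\<lambda>x. x j) \<in> borel_measurable (vec_M p)"
  unfolding vec_M_def by (rule measurable_component_singleton[OF assms])

text \<open>All parameters are covered, not only the finite class, because a joint law is built from
  a kernel on the whole parameter space. The bound \<open>i \<le> d\<close> keeps the layer index
  among the stored matrices.\<close>

lemma measurable_layer_law:
  assumes \<sigma>: "\<sigma> > 0" and "i \<le> d"
  shows "(\<lambda>(W, y). layer_law p (\<lambda>_. gauss p \<sigma>) (\<lambda>t. t) W y i)
    \<in> param_M p d \<Otimes>\<^sub>M label_M \<rightarrow>\<^sub>M prob_algebra (vec_M p)"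
  using \<open>i \<le> d\<close>
proof (induction i)
  case 0
  have "(\<lambda>(W, y). \<lambda>j\<in>{1..p}. y * fst W j) \<in> param_M p d \<Otimes>\<^sub>M label_M \<rightarrow>\<^sub>M vec_M p"
    unfolding vec_M_def case_prod_beta
    by (intro measurable_restrict borel_measurable_times
        measurable_compose[OF measurable_snd measurable_label_M] measurable_compose[OF measurable_fst measurable_param_fst])
  from measurable_compose[OF this measurable_gauss[OF \<sigma>]] show ?case
    by (simp add: case_prod_beta)
next
  case (Suc i)
  then have IH: "(\<lambda>Wy. layer_law p (\<lambda>_. gauss p \<sigma>) (\<lambda>t. t) (fst Wy) (snd Wy) i)
    \<in> param_M p d \<Otimes>\<^sub>M label_M \<rightarrow>\<^sub>M prob_algebra (vec_M p)"
    by (simp add: case_prod_beta)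
  have "(\<lambda>(Wy, z). mat_vec p (snd (fst Wy) (Suc i)) (\<lambda>j\<in>{1..p}. z j))
     \<in> (param_M p d \<Otimes>\<^sub>M label_M) \<Otimes>\<^sub>M vec_M p \<rightarrow>\<^sub>M PiM {1..p} (\<lambda>_. borel)"
    unfolding mat_vec_def case_prod_beta
  proof (intro measurable_restrict borel_measurable_sum borel_measurable_times)
    fix j k assume jk: "j \<in> {1..p}" "k \<in> {1..p}"
    show "(\<lambda>x. snd (fst (fst x)) (Suc i) (j, k)) \<in> borel_measurable ((param_M p d \<Otimes>\<^sub>M label_M) \<Otimes>\<^sub>M vec_M p)"
      using Suc.prems jk
      by (intro measurable_compose[OF measurable_fst] measurable_compose[OF measurable_fst] measurable_param_snd) auto
    show "(\<lambda>x. (\<lambda>j\<in>{1..p}. snd x j) k) \<in> borel_measurable ((param_M p d \<Otimes>\<^sub>M label_M) \<Otimes>\<^sub>M vec_M p)"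
      using measurable_compose[OF measurable_snd measurable_vec_component[OF jk(2)]] jk by simp
  qed
  from measurable_compose[OF this[folded vec_M_def] measurable_gauss[OF \<sigma>]]
  have "(\<lambda>(Wy, z). gauss p \<sigma> (mat_vec p (snd (fst Wy) (Suc i)) (\<lambda>j\<in>{1..p}. z j)))
     \<in> (param_M p d \<Otimes>\<^sub>M label_M) \<Otimes>\<^sub>M vec_M p \<rightarrow>\<^sub>M prob_algebra (vec_M p)"
    by (simp add: case_prod_beta)
  from measurable_bind_prob_space2[OF IH this] show ?case
    by (simp add: case_prod_beta)
qed

lemma measurable_gauss_x_given_y:
  assumes "\<sigma> > 0"
  shows "(\<lambda>(W, y). gauss_x_given_y p d \<sigma> W y) \<in> param_M p d \<Otimes>\<^sub>M label_M \<rightarrow>\<^sub>M prob_algebra (vec_M p)"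
  unfolding gauss_x_given_y_def by (rule measurable_layer_law[OF assms order_refl])

lemma uniform_label_in_prob_algebra: "uniform_count_measure {-1, 1} \<in> space (prob_algebra label_M)"
  by (simp add: space_prob_algebra label_M_def prob_space_uniform_count_measure sets_uniform_count_measure)

lemma gauss_network_eq:
  "gauss_network p d \<sigma> W =
    uniform_count_measure {-1, 1} \<bind> (\<lambda>y. distr (gauss_x_given_y p d \<sigma> W y) (data_M p) (\<lambda>x. (x, y)))"
  by (simp add: gauss_network_def network_law_def gauss_x_given_y_def)

lemma measurable_gauss_network_kernel:
  assumes "\<sigma> > 0"
  shows "(\<lambda>(W, y). distr (gauss_x_given_y p d \<sigma> W y) (data_M p) (\<lambda>x. (x, y)))
    \<in> param_M p d \<Otimes>\<^sub>M label_M \<rightarrow>\<^sub>M prob_algebra (data_M p)"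
proof -
  have "(\<lambda>Wy. distr (gauss_x_given_y p d \<sigma> (fst Wy) (snd Wy)) (data_M p) (\<lambda>x. (x, snd Wy)))
    \<in> param_M p d \<Otimes>\<^sub>M label_M \<rightarrow>\<^sub>M prob_algebra (data_M p)"
    using measurable_gauss_x_given_y[OF assms, of p d]
    by (intro measurable_distr_prob_space2[where M="vec_M p"]) (auto simp: case_prod_beta data_M_def)
  then show ?thesis by (simp add: case_prod_beta)
qed

lemma measurable_gauss_network:
  assumes "\<sigma> > 0"
  shows "gauss_network p d \<sigma> \<in> param_M p d \<rightarrow>\<^sub>M prob_algebra (data_M p)"
  unfolding gauss_network_eq
  by (rule measurable_bind_prob_space2[OF measurable_const[OF uniform_label_in_prob_algebra]
        measurable_gauss_network_kernel[OF assms]])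

lemma measurable_joint_kernel:
  assumes "\<kappa> \<in> param_M p d \<rightarrow>\<^sub>M prob_algebra (data_M p)"
  shows "(\<lambda>W. distr (PiM {1..n} (\<lambda>_. \<kappa> W)) (param_M p d \<Otimes>\<^sub>M sample_M p n) (\<lambda>S. (W, S)))
    \<in> param_M p d \<rightarrow>\<^sub>M prob_algebra (param_M p d \<Otimes>\<^sub>M sample_M p n)"
  by (intro measurable_distr_prob_space2[where M="sample_M p n"])
    (auto simp: sample_M_def intro!: measurable_PiM_kernel assms)

lemma gauss_network_in_network_laws:
  assumes "\<sigma> > 0"
  shows "gauss_network p d \<sigma> W \<in> network_laws p d W"
  unfolding network_laws_def gauss_network_def
  using uniform_label_in_prob_algebra measurable_gauss[OF assms]
  by (intro CollectI exI[of _ "uniform_count_measure {-1, 1}"] exI[of _ "\<lambda>_. gauss p \<sigma>"] exI[of _ "\<lambda>t. t"]) auto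

section \<open>Measurability of the conditional mean and the risk\<close>

lemma measurable_cond_mean:
  assumes "\<sigma> > 0" "j \<in> {1..p}"
  shows "(\<lambda>(W, y). cond_mean p d \<sigma> W y j) \<in> borel_measurable (param_M p d \<Otimes>\<^sub>M label_M)"
proof -
  note measurable_compose[OF measurable_prob_algebraD[OF measurable_gauss_x_given_y[OF assms(1), of p d]]
      integral_measurable_subprob_algebra[OF measurable_vec_component[OF assms(2)]]]
  then show ?thesis using assms(2) by (simp add: case_prod_beta cond_mean_def)
qed

text \<open>The event depends on \<open>V\<close> and its probability on \<open>W\<close>. Hence
  measurability is shown for the graph of the event over pairs of parameters; the mass of a section
  of a measurable set under a kernel is then measurable.\<close>

lemma measurable_risk:
  assumes "\<sigma> > 0"
  shows "(\<lambda>(V, W). risk p d \<sigma> V W) \<in> borel_measurable (param_M p d \<Otimes>\<^sub>M param_M p d)"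
proof -
  let ?M = "param_M p d \<Otimes>\<^sub>M param_M p d"
  let ?A = "\<lambda>VW. {(x, y) \<in> space (data_M p). inner_vec p x (cond_mean p d \<sigma> (fst VW) y) \<le> 0}"
  have "(\<lambda>z. inner_vec p (fst (snd z)) (cond_mean p d \<sigma> (fst (fst z)) (snd (snd z)))) \<in> borel_measurable (?M \<Otimes>\<^sub>M data_M p)"
    unfolding inner_vec_def data_M_def
  proof (intro borel_measurable_sum borel_measurable_times)
    fix j assume j: "j \<in> {1..p}"
    show "(\<lambda>z. fst (snd z) j) \<in> borel_measurable (?M \<Otimes>\<^sub>M (vec_M p \<Otimes>\<^sub>M label_M))"
      by (intro measurable_compose[OF measurable_snd] measurable_compose[OF measurable_fst] measurable_vec_component[OF j])
    have "(\<lambda>z. (fst (fst z), snd (snd z))) \<in> ?M \<Otimes>\<^sub>M (vec_M p \<Otimes>\<^sub>M label_M) \<rightarrow>\<^sub>M param_M p d \<Otimes>\<^sub>M label_M"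
      by measurable
    from measurable_compose[OF this measurable_cond_mean[OF assms j]]
    show "(\<lambda>z. cond_mean p d \<sigma> (fst (fst z)) (snd (snd z)) j) \<in> borel_measurable (?M \<Otimes>\<^sub>M (vec_M p \<Otimes>\<^sub>M label_M))"
      by simp
  qed
  from borel_measurable_le[OF this borel_measurable_const[of 0]]
  have "{z \<in> space (?M \<Otimes>\<^sub>M data_M p). inner_vec p (fst (snd z)) (cond_mean p d \<sigma> (fst (fst z)) (snd (snd z))) \<le> 0} \<in> sets (?M \<Otimes>\<^sub>M data_M p)"
    by simp
  also have "{z \<in> space (?M \<Otimes>\<^sub>M data_M p). inner_vec p (fst (snd z)) (cond_mean p d \<sigma> (fst (fst z)) (snd (snd z))) \<le> 0}
      = Sigma (space ?M) ?A"
    by (auto simp: space_pair_measure)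
  finally have S: "Sigma (space ?M) ?A \<in> sets (?M \<Otimes>\<^sub>M data_M p)" .
  have "(\<lambda>VW. measure (gauss_network p d \<sigma> (snd VW)) (?A VW)) \<in> borel_measurable ?M"
    by (rule measure_measurable_subprob_algebra2[OF S])
      (rule measurable_compose[OF measurable_snd measurable_prob_algebraD[OF measurable_gauss_network[OF assms]]])
  also have "?this \<longleftrightarrow> (\<lambda>(V, W). risk p d \<sigma> V W) \<in> borel_measurable ?M"
  proof (rule measurable_cong)
    fix VW assume "VW \<in> space ?M"
    then have "sets (gauss_network p d \<sigma> (snd VW)) = sets (data_M p)"
      using measurable_space[OF measurable_gauss_network[OF assms]]
      by (auto simp: space_pair_measure space_prob_algebra)
    then have "space (gauss_network p d \<sigma> (snd VW)) = space (data_M p)" by (rule sets_eq_imp_space_eq)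
    then show "measure (gauss_network p d \<sigma> (snd VW)) (?A VW) = (case VW of (V, W) \<Rightarrow> risk p d \<sigma> V W)"
      by (simp add: risk_def case_prod_beta)
  qed
  finally show ?thesis .
qed

lemma measurable_excess_risk:
  assumes "\<sigma> > 0"
  shows "(\<lambda>(V, W). excess_risk p d \<sigma> V W) \<in> borel_measurable (param_M p d \<Otimes>\<^sub>M param_M p d)"
proof -
  have "(\<lambda>z. risk p d \<sigma> (snd z) (snd z)) \<in> borel_measurable (param_M p d \<Otimes>\<^sub>M param_M p d)"
    using measurable_compose[OF _ measurable_risk[OF assms], of "\<lambda>z. (snd z, snd z)" "param_M p d \<Otimes>\<^sub>M param_M p d" p d]
    by simp
  with measurable_risk[OF assms, of p d] show ?thesis
    unfolding excess_risk_def case_prod_beta by (rule borel_measurable_diff)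
qed

section \<open>Networks with parameter in the finite class\<close>

definition block_mat :: "nat \<Rightarrow> nat \<Rightarrow> real \<Rightarrow> (nat \<Rightarrow> nat) \<Rightarrow> mat" where
  "block_mat p r c \<pi> = (\<lambda>(i, j)\<in>{1..p} \<times> {1..p}.
     if i \<le> r \<and> j \<le> r then (if i = \<pi> j then 1 else 0) else if i = j then c else 0)"

text \<open>For matrices of the class with \<open>r \<le> p\<close> the choice is forced, since the
  entries equal to 1 in the upper block determine \<pi>; for other matrices the value is
  arbitrary.\<close>

definition block_perm :: "nat \<Rightarrow> nat \<Rightarrow> real \<Rightarrow> mat \<Rightarrow> nat \<Rightarrow> nat" where
  "block_perm p r c A = (SOME \<pi>. \<pi> permutes {1..r} \<and> A = block_mat p r c \<pi>)"

text \<open>Later layers act on the left: for parameters in the class, the entry of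
  \<open>w\<^sub>0\<close> at \<open>j \<le> r\<close> has moved to position
  \<open>perm_prod p r c W i j\<close> after \<open>i\<close> layers.\<close>

primrec perm_prod :: "nat \<Rightarrow> nat \<Rightarrow> real \<Rightarrow> param \<Rightarrow> nat \<Rightarrow> nat \<Rightarrow> nat" where
  "perm_prod p r c W 0 = id"
| "perm_prod p r c W (Suc i) = block_perm p r c (snd W (Suc i)) \<circ> perm_prod p r c W i"

text \<open>The formulas for the conditional mean and standard deviation of \<open>z\<^sub>i\<close> given \<open>y = 1\<close> are valid only
  for parameters in the class.\<close>

definition layer_mean :: "nat \<Rightarrow> nat \<Rightarrow> real \<Rightarrow> param \<Rightarrow> nat \<Rightarrow> vec" where
  "layer_mean p r c W i j = (if j \<le> r then fst W (inv (perm_prod p r c W i) j) else c ^ i * fst W j)"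

definition layer_sd :: "nat \<Rightarrow> real \<Rightarrow> real \<Rightarrow> nat \<Rightarrow> vec" where
  "layer_sd r c \<sigma> i j = \<sigma> * sqrt (if j \<le> r then real i + 1 else \<Sum>k\<le>i. c ^ (2 * k))"

text \<open>\<open>L\<close> is left open because the pure noise law has this form as well as the
  networks.\<close>

definition label_mixture :: "nat \<Rightarrow> (real \<Rightarrow> vec measure) \<Rightarrow> (vec \<times> real) measure" where
  "label_mixture p L = uniform_count_measure {-1, 1} \<bind> (\<lambda>y. distr (L y) (data_M p) (\<lambda>x. (x, y)))"

lemma G_mat_eq: "G_mat p r c = block_mat p r c ` {\<pi>. \<pi> permutes {1..r}}"
  unfolding G_mat_def block_mat_def by auto

lemma block_perm:
  assumes "A \<in> G_mat p r c"
  shows block_perm_permutes: "block_perm p r c A permutes {1..r}"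
    and block_mat_block_perm: "block_mat p r c (block_perm p r c A) = A"
proof -
  have "\<exists>\<pi>. \<pi> permutes {1..r} \<and> A = block_mat p r c \<pi>"
    using assms by (auto simp: G_mat_eq)
  from someI_ex[OF this] show "block_perm p r c A permutes {1..r}"
    "block_mat p r c (block_perm p r c A) = A"
    by (simp_all add: block_perm_def)
qed

lemma mat_vec_block_mat:
  assumes \<pi>: "\<pi> permutes {1..r}" and i: "i \<in> {1..p}" and r: "r \<le> p"
  shows "mat_vec p (block_mat p r c \<pi>) v i = (if i \<le> r then v (inv \<pi> i) else c * v i)"
proof -
  have "mat_vec p (block_mat p r c \<pi>) v i = (\<Sum>j\<in>{1..p}. block_mat p r c \<pi> (i, j) * v j)"
    using i by (simp add: mat_vec_def)
  also have "\<dots> = (\<Sum>j\<in>{1..p}. if j = (if i \<le> r then inv \<pi> i else i) then (if i \<le> r then v j else c * v j) else 0)"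
  proof (rule sum.cong)
    fix j assume j: "j \<in> {1..p}"
    have "i = \<pi> j \<longleftrightarrow> j = inv \<pi> i" using permutes_inverses[OF \<pi>] by metis
    moreover have "inv \<pi> i \<le> r" if "i \<le> r"
      using permutes_in_image[OF permutes_inv[OF \<pi>], of i] i that by auto
    ultimately show "block_mat p r c \<pi> (i, j) * v j =
        (if j = (if i \<le> r then inv \<pi> i else i) then (if i \<le> r then v j else c * v j) else 0)"
      using i j by (auto simp: block_mat_def)
  qed simp
  also have "\<dots> = (if i \<le> r then v (inv \<pi> i) else c * v i)"
    using i r permutes_in_image[OF permutes_inv[OF \<pi>], of i] by (auto simp: sum.delta)
  finally show ?thesis .
qed

section \<open>Laws with a uniform label\<close>

lemma nn_integral_uniform_count_measure:
  assumes "finite A"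
  shows "(\<integral>\<^sup>+x. f x \<partial>uniform_count_measure A) = (\<Sum>x\<in>A. f x) / of_nat (card A)"
proof (cases "A = {}")
  case False
  have "ennreal (1 / real (card A)) = 1 / of_nat (card A)"
    using assms False by (simp add: ennreal_of_nat_eq_real_of_nat divide_ennreal[symmetric] card_gt_0_iff)
  then show ?thesis
    using assms unfolding uniform_count_measure_def
    by (subst nn_integral_point_measure_finite)
      (simp_all add: divide_ennreal_def sum_distrib_right mult.commute)
qed (simp add: uniform_count_measure_def nn_integral_point_measure_finite)

lemma label_mixture_kernel:
  assumes "\<And>y. y \<in> {-1, 1} \<Longrightarrow> L y \<in> space (prob_algebra (vec_M p))"
  shows "(\<lambda>y. distr (L y) (data_M p) (\<lambda>x. (x, y))) \<in> label_M \<rightarrow>\<^sub>M prob_algebra (data_M p)"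
proof -
  have "distr (L y) (data_M p) (\<lambda>x. (x, y)) \<in> space (prob_algebra (data_M p))" if y: "y \<in> {-1, 1}" for y
  proof -
    have [measurable_cong]: "sets (L y) = sets (vec_M p)" and "prob_space (L y)"
      using assms[OF y] by (auto simp: space_prob_algebra)
    moreover have "(\<lambda>x. (x, y)) \<in> L y \<rightarrow>\<^sub>M data_M p"
      unfolding data_M_def using y by (intro measurable_Pair) auto
    ultimately show ?thesis
      by (auto simp: space_prob_algebra intro: prob_space.prob_space_distr)
  qed
  then show ?thesis by (auto simp: label_M_def)
qed

lemma label_mixture_in_prob_algebra:
  assumes "\<And>y. y \<in> {-1, 1} \<Longrightarrow> L y \<in> space (prob_algebra (vec_M p))"
  shows "label_mixture p L \<in> space (prob_algebra (data_M p))"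
  unfolding label_mixture_def
  using prob_space_bind'[OF uniform_label_in_prob_algebra label_mixture_kernel[OF assms]]
    sets_bind'[OF uniform_label_in_prob_algebra label_mixture_kernel[OF assms]]
  by (simp add: space_prob_algebra)

lemma nn_integral_label_mixture:
  assumes L: "\<And>y. y \<in> {-1, 1} \<Longrightarrow> L y \<in> space (prob_algebra (vec_M p))"
    and f: "f \<in> borel_measurable (data_M p)"
  shows "(\<integral>\<^sup>+z. f z \<partial>label_mixture p L) = (\<Sum>y\<in>{-1, 1}. \<integral>\<^sup>+x. f (x, y) \<partial>L y) / 2"
proof -
  have "(\<integral>\<^sup>+z. f z \<partial>label_mixture p L)
     = (\<integral>\<^sup>+y. \<integral>\<^sup>+z. f z \<partial>distr (L y) (data_M p) (\<lambda>x. (x, y)) \<partial>uniform_count_measure {-1, 1})"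
    unfolding label_mixture_def
  proof (rule nn_integral_bind[OF f])
    have "sets (uniform_count_measure {-1, 1}) = sets label_M"
      by (simp add: label_M_def sets_uniform_count_measure)
    then show "(\<lambda>y. distr (L y) (data_M p) (\<lambda>x. (x, y))) \<in> uniform_count_measure {-1, 1} \<rightarrow>\<^sub>M subprob_algebra (data_M p)"
      using measurable_prob_algebraD[OF label_mixture_kernel[OF L]] by (simp cong: measurable_cong_sets)
  qed
  also have "\<dots> = (\<Sum>y\<in>{-1, 1}. \<integral>\<^sup>+z. f z \<partial>distr (L y) (data_M p) (\<lambda>x. (x, y))) / 2"
    by (simp add: nn_integral_uniform_count_measure)
  also have "(\<Sum>y\<in>{-1, 1::real}. \<integral>\<^sup>+z. f z \<partial>distr (L y) (data_M p) (\<lambda>x. (x, y)))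
    = (\<Sum>y\<in>{-1, 1}. \<integral>\<^sup>+x. f (x, y) \<partial>L y)"
  proof (rule sum.cong)
    fix y :: real assume y: "y \<in> {-1, 1}"
    have [measurable_cong]: "sets (L y) = sets (vec_M p)"
      using L[OF y] by (auto simp: space_prob_algebra)
    have "(\<lambda>x. (x, y)) \<in> L y \<rightarrow>\<^sub>M data_M p"
      unfolding data_M_def using y by (intro measurable_Pair) auto
    with f show "(\<integral>\<^sup>+z. f z \<partial>distr (L y) (data_M p) (\<lambda>x. (x, y))) = (\<integral>\<^sup>+x. f (x, y) \<partial>L y)"
      by (intro nn_integral_distr) auto
  qed simp
  finally show ?thesis .
qed

lemma PiM_normal_law_in_prob_algebra:
  assumes "\<And>j. j \<in> {1..p} \<Longrightarrow> s j > 0"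
  shows "PiM {1..p} (\<lambda>j. normal_law (m j) (s j)) \<in> space (prob_algebra (vec_M p))"
  unfolding space_prob_algebra vec_M_def
  using assms by (auto intro!: prob_space_PiM prob_space_normal_law cong: sets_PiM_cong)

section \<open>Elementary estimates and the size of the class\<close>

lemma sum_inverse_powers: "(\<Sum>j\<in>{1..q}. 1 / 2 ^ j) = 1 - 1 / (2::real) ^ q"
  by (induction q) (auto simp: field_simps)

text \<open>Distinct squared entries of the upper block are powers of 2 with ratio at least 2. The
  moduli then differ by a factor of at least \<open>sqrt 2\<close>, for which 3/4 and 5/4 serve as
  rational substitutes. The loss of 1/16 = \<open>2 ^ (-4)\<close> is the source of the four
  undetermined positions.\<close>

lemma square_diff_ge:
  fixes a b :: real
  assumes "a\<^sup>2 \<ge> 2 * b\<^sup>2 \<or> b\<^sup>2 \<ge> 2 * a\<^sup>2"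
  shows "(a - b)\<^sup>2 \<ge> a\<^sup>2 / 16"
proof -
  define x y where "x = \<bar>a\<bar>" and "y = \<bar>b\<bar>"
  have xy: "x \<ge> 0" "y \<ge> 0" "x\<^sup>2 = a\<^sup>2" "y\<^sup>2 = b\<^sup>2" by (simp_all add: x_def y_def)
  have "x / 4 \<le> \<bar>x - y\<bar>"
    using assms
  proof
    assume "a\<^sup>2 \<ge> 2 * b\<^sup>2"
    then have "y\<^sup>2 \<le> 9 / 16 * x\<^sup>2" using xy zero_le_power2[of a] by linarith
    then have "y\<^sup>2 \<le> (3 / 4 * x)\<^sup>2" by (simp add: power2_eq_square)
    then have "y \<le> 3 / 4 * x" by (rule power2_le_imp_le) (use xy in simp)
    then show ?thesis by arith
  next
    assume "b\<^sup>2 \<ge> 2 * a\<^sup>2"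
    then have "25 / 16 * x\<^sup>2 \<le> y\<^sup>2" using xy zero_le_power2[of a] by linarith
    then have "(5 / 4 * x)\<^sup>2 \<le> y\<^sup>2" by (simp add: power2_eq_square)
    then have "5 / 4 * x \<le> y" by (rule power2_le_imp_le) (use xy in simp)
    then show ?thesis by arith
  qed
  also have "\<dots> \<le> \<bar>a - b\<bar>" unfolding x_def y_def by (rule abs_triangle_ineq3)
  finally have "(x / 4)\<^sup>2 \<le> \<bar>a - b\<bar>\<^sup>2" using xy by (intro power_mono) auto
  then show ?thesis using xy by (simp add: power_divide)
qed

lemma card_G_vec: "card (G_vec p) = 2 ^ p"
proof -
  have "{s / q | s. s \<in> {-1, 1}} = (\<lambda>s. s / q) ` {-1, 1}" for q :: real
    by (rule Setcompr_eq_image)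
  moreover have "inj_on (\<lambda>s. s / sqrt (2 ^ min j (p - 1))) {-1, 1}" for j by (auto simp: inj_on_def)
  ultimately have "card {s / sqrt (2 ^ min j (p - 1)) | s. s \<in> {-1, 1}} = 2" for j
    by (simp only: card_image) simp
  then show ?thesis unfolding G_vec_def by (subst card_PiE) simp_all
qed

lemma finite_G_vec: "finite (G_vec p)"
  by (rule card_ge_0_finite) (simp add: card_G_vec)

text \<open>The entry 1 in column \<open>j\<close> sits in row \<open>\<pi> j\<close>, and
  \<open>r \<le> p\<close> makes the whole block visible, so different permutations give different
  matrices.\<close>

lemma card_G_mat:
  assumes "r \<le> p"
  shows "card (G_mat p r c) = fact r"
proof -
  have "inj_on (block_mat p r c) {\<pi>. \<pi> permutes {1..r}}"
  proof (rule inj_onI, clarify)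
    fix \<pi> \<pi>' assume \<pi>: "\<pi> permutes {1..r}" "\<pi>' permutes {1..r}" and eq: "block_mat p r c \<pi> = block_mat p r c \<pi>'"
    have "\<pi> j = \<pi>' j" for j
    proof (cases "j \<in> {1..r}")
      case True
      then have "\<pi> j \<in> {1..r}" using permutes_in_image[OF \<pi>(1)] by blast
      with True assms fun_cong[OF eq, of "(\<pi> j, j)"] show ?thesis
        by (auto simp: block_mat_def split: if_splits)
    next
      case False
      then show ?thesis using permutes_not_in[OF \<pi>(1)] permutes_not_in[OF \<pi>(2)] by metis
    qed
    then show "\<pi> = \<pi>'" by (rule ext)
  qed
  then show ?thesis
    unfolding G_mat_eq by (simp add: card_image card_permutations)
qed

lemma finite_G_mat: "finite (G_mat p r c)"
  unfolding G_mat_eq by (intro finite_imageI finite_permutations) simp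

text \<open>The cardinality of \<open>G_mat\<close> stays unevaluated: all but one of its
  \<open>d\<close> factors cancel against the count of close parameters.\<close>

lemma card_G_class: "card (G_class p d r c) = 2 ^ p * card (G_mat p r c) ^ d"
  by (simp add: G_class_def card_cartesian_product card_G_vec card_PiE)

lemma finite_G_class: "finite (G_class p d r c)"
  unfolding G_class_def by (intro finite_cartesian_product finite_G_vec finite_PiE finite_G_mat) simp

text \<open>The value of \<open>c\<close> enters through these two bounds;
  \<open>c \<le> 1 / 2\<close> reflects \<open>p - r \<ge> 1\<close>.\<close>

locale backwards_class =
  fixes d p r :: nat and \<sigma> c :: real
  assumes d_pos: "1 \<le> d" and r_pos: "1 \<le> r" and r_less: "r < p"
    and sigma_pos: "0 < \<sigma>" and c_pos: "0 < c" and c_le: "c \<le> 1 / 2"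
begin

abbreviation "G \<equiv> G_class p d r c"
abbreviation "mean W \<equiv> layer_mean p r c W d"
abbreviation "sd \<equiv> layer_sd r c \<sigma> d"
abbreviation "total_perm W \<equiv> perm_prod p r c W d"

section \<open>Layer laws for parameters in the class\<close>

lemma layer_sd_pos: "layer_sd r c \<sigma> i j > 0"
proof -
  have "(\<Sum>k\<le>i. c ^ (2 * k)) > 0" using c_pos by (intro sum_pos) auto
  then show ?thesis using sigma_pos by (auto simp: layer_sd_def)
qed

lemma layer_sd_square:
  "(layer_sd r c \<sigma> i j)\<^sup>2 = \<sigma>\<^sup>2 * (if j \<le> r then real i + 1 else \<Sum>k\<le>i. c ^ (2 * k))"
  using c_pos by (auto simp: layer_sd_def power_mult_distrib sum_nonneg)

lemma G_snd: "W \<in> G \<Longrightarrow> i \<in> {1..d} \<Longrightarrow> snd W i \<in> G_mat p r c"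
  by (auto simp: G_class_def)

lemma perm_prod_permutes: "W \<in> G \<Longrightarrow> i \<le> d \<Longrightarrow> perm_prod p r c W i permutes {1..r}"
proof (induction i)
  case (Suc i)
  then show ?case
    using permutes_compose[of "perm_prod p r c W i" "{1..r}" "block_perm p r c (snd W (Suc i))"]
      block_perm_permutes[OF G_snd[OF Suc.prems(1), of "Suc i"]] by (simp add: o_def)
qed (simp add: permutes_id)

lemma G_subset_space: "G \<subseteq> space (param_M p d)"
proof
  fix W assume W: "W \<in> G"
  then have "fst W \<in> G_vec p" "snd W \<in> PiE {1..d} (\<lambda>_. G_mat p r c)"
    by (auto simp only: G_class_def mem_Times_iff)
  moreover have "G_vec p \<subseteq> space (vec_M p)"
    unfolding G_vec_def vec_M_def space_PiM by (rule PiE_mono) simp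
  moreover have "block_mat p r c \<pi> \<in> space (mat_M p)" for \<pi>
    unfolding block_mat_def mat_M_def space_PiM by (rule restrict_PiE_iff[THEN iffD2]) simp
  then have "G_mat p r c \<subseteq> space (mat_M p)" by (auto simp only: G_mat_eq)
  then have "PiE {1..d} (\<lambda>_. G_mat p r c) \<subseteq> space (PiM {1..d} (\<lambda>_. mat_M p))"
    unfolding space_PiM by (rule PiE_mono)
  ultimately show "W \<in> space (param_M p d)"
    unfolding param_M_def space_pair_measure mem_Times_iff by blast
qed

text \<open>A layer of the class permutes and scales independent normal coordinates and adds
  independent noise, so the law remains a product of normal laws. Permuting the upper block does not
  change its covariance, because the variances there are equal.\<close>

lemma layer_law_eq:
  assumes W: "W \<in> G" and "i \<le> d"
  shows "layer_law p (\<lambda>_. gauss p \<sigma>) (\<lambda>t. t) W y i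
    = PiM {1..p} (\<lambda>j. normal_law (y * layer_mean p r c W i j) (layer_sd r c \<sigma> i j))"
  using \<open>i \<le> d\<close>
proof (induction i)
  case 0
  show ?case
    by (auto simp: gauss_eq layer_mean_def layer_sd_def intro!: PiM_cong)
next
  case (Suc i)
  define \<pi> where "\<pi> = block_perm p r c (snd W (Suc i))"
  have A: "snd W (Suc i) \<in> G_mat p r c" using W Suc.prems by (intro G_snd) auto
  have \<pi>: "\<pi> permutes {1..r}" and Aeq: "snd W (Suc i) = block_mat p r c \<pi>"
    using block_perm[OF A] by (simp_all add: \<pi>_def)
  define \<rho> where "\<rho> = inv \<pi>"
  define a where "a j = (if j \<le> r then 1 else c)" for j :: nat
  define M where "M j = normal_law (y * layer_mean p r c W i j) (layer_sd r c \<sigma> i j)" for j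
  have \<rho>r: "\<rho> permutes {1..r}" unfolding \<rho>_def by (rule permutes_inv[OF \<pi>])
  \<comment> \<open>As a permutation of all coordinates, \<rho> fixes the lower block.\<close>
  then have \<rho>: "\<rho> permutes {1..p}" by (rule permutes_subset) (use r_less in auto)
  have \<rho>_le: "\<rho> j \<le> r \<longleftrightarrow> j \<le> r" if "j \<in> {1..p}" for j
    using permutes_in_image[OF \<rho>r, of j] permutes_in_image[OF \<rho>, of j] that by auto
  have \<rho>_gt: "\<rho> j = j" if "\<not> j \<le> r" for j
    using permutes_not_in[OF \<rho>r, of j] that by auto
  have gauss: "gauss p \<sigma> (mat_vec p (snd W (Suc i)) (\<lambda>j\<in>{1..p}. z j)) = PiM {1..p} (\<lambda>j. normal_law (a j * z (\<rho> j)) \<sigma>)" for z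
    unfolding gauss_eq
  proof (rule PiM_cong)
    fix j assume j: "j \<in> {1..p}"
    have "\<rho> j \<in> {1..p}" using permutes_in_image[OF \<rho>] j by simp
    then show "normal_law (mat_vec p (snd W (Suc i)) (\<lambda>j\<in>{1..p}. z j) j) \<sigma> = normal_law (a j * z (\<rho> j)) \<sigma>"
      using j r_less \<rho>_gt[of j] by (auto simp: Aeq mat_vec_block_mat[OF \<pi> j] \<rho>_def[symmetric] a_def)
  qed simp
  have "layer_law p (\<lambda>_. gauss p \<sigma>) (\<lambda>t. t) W y (Suc i)
    = PiM {1..p} M \<bind> (\<lambda>z. PiM {1..p} (\<lambda>j. normal_law (a j * z (\<rho> j)) \<sigma>))"
    unfolding layer_law.simps Suc.IH[OF Suc_leD[OF Suc.prems]] gauss M_def ..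
  also have "\<dots> = PiM {1..p} (\<lambda>j. M (\<rho> j) \<bind> (\<lambda>x. normal_law (a j * x) \<sigma>))"
  proof (rule bind_PiM_kernel[OF _ \<rho>])
    show "prob_space (M j)" for j
      unfolding M_def by (rule prob_space_normal_law) (rule layer_sd_pos)
    show "(\<lambda>x. normal_law (a j * x) \<sigma>) \<in> M (\<rho> j) \<rightarrow>\<^sub>M prob_algebra borel" for j
      unfolding M_def by (rule measurable_compose[OF _ measurable_normal_law[OF sigma_pos]]) simp
  qed simp
  also have "\<dots> = PiM {1..p} (\<lambda>j. normal_law (y * layer_mean p r c W (Suc i) j) (layer_sd r c \<sigma> (Suc i) j))"
  proof (rule PiM_cong)
    fix j assume j: "j \<in> {1..p}"
    have a0: "a j \<noteq> 0" using c_pos by (simp add: a_def)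
    have "inv (perm_prod p r c W (Suc i)) = inv (perm_prod p r c W i) \<circ> \<rho>"
      unfolding \<rho>_def \<pi>_def perm_prod.simps
      using perm_prod_permutes[OF W, of i] block_perm_permutes[OF A] Suc.prems
      by (intro o_inv_distrib) (auto dest: permutes_bij)
    then have mean: "a j * (y * layer_mean p r c W i (\<rho> j)) = y * layer_mean p r c W (Suc i) j"
      using \<rho>_le[OF j] \<rho>_gt[of j] by (auto simp: layer_mean_def a_def)
    \<comment> \<open>In units of \<open>\<sigma>\<^sup>2\<close>, one layer takes a lower variance
      \<open>v\<close> to \<open>1 + c\<^sup>2 * v\<close> and an upper one to
      \<open>1 + v\<close>.\<close>
    have "(\<Sum>k\<le>Suc i. c ^ (2 * k)) = 1 + c\<^sup>2 * (\<Sum>k\<le>i. c ^ (2 * k))"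
      by (subst sum.atMost_Suc_shift) (simp add: sum_distrib_left power_add[symmetric])
    then have "(a j)\<^sup>2 * (layer_sd r c \<sigma> i (\<rho> j))\<^sup>2 + \<sigma>\<^sup>2 = (layer_sd r c \<sigma> (Suc i) j)\<^sup>2"
      unfolding layer_sd_square using \<rho>_le[OF j] by (auto simp: a_def algebra_simps)
    then have sd: "sqrt ((a j)\<^sup>2 * (layer_sd r c \<sigma> i (\<rho> j))\<^sup>2 + \<sigma>\<^sup>2) = layer_sd r c \<sigma> (Suc i) j"
      using layer_sd_pos[of "Suc i" j] by simp
    show "M (\<rho> j) \<bind> (\<lambda>x. normal_law (a j * x) \<sigma>)
      = normal_law (y * layer_mean p r c W (Suc i) j) (layer_sd r c \<sigma> (Suc i) j)"
      unfolding M_def bind_normal_law[OF layer_sd_pos sigma_pos a0] mean sd ..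
  qed simp
  finally show ?case .
qed

lemma gauss_x_given_y_eq:
  "W \<in> G \<Longrightarrow> gauss_x_given_y p d \<sigma> W y = PiM {1..p} (\<lambda>j. normal_law (y * mean W j) (sd j))"
  unfolding gauss_x_given_y_def by (rule layer_law_eq) auto

lemma gauss_network_eq_mixture:
  "W \<in> G \<Longrightarrow> gauss_network p d \<sigma> W = label_mixture p (\<lambda>y. PiM {1..p} (\<lambda>j. normal_law (y * mean W j) (sd j)))"
  by (simp add: gauss_network_eq label_mixture_def gauss_x_given_y_eq)

lemma sets_gauss_network: "W \<in> G \<Longrightarrow> sets (gauss_network p d \<sigma> W) = sets (data_M p)"
  and prob_space_gauss_network: "W \<in> G \<Longrightarrow> prob_space (gauss_network p d \<sigma> W)"
  using measurable_space[OF measurable_gauss_network[OF sigma_pos, of p d], of W] G_subset_space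
  by (simp_all only: space_prob_algebra mem_Collect_eq) blast+

section \<open>Conditional means and risks\<close>

lemma cond_mean_eq:
  assumes W: "W \<in> G" and j: "j \<in> {1..p}"
  shows "cond_mean p d \<sigma> W y j = y * mean W j"
proof -
  let ?N = "\<lambda>j. normal_law (y * mean W j) (sd j)"
  have p: "prob_space (?N i)" for i by (rule prob_space_normal_law) (rule layer_sd_pos)
  have "cond_mean p d \<sigma> W y j = (\<integral>x. x j \<partial>PiM {1..p} ?N)"
    using j by (simp add: cond_mean_def gauss_x_given_y_eq[OF W])
  also have "\<dots> = (\<integral>x. x \<partial>distr (PiM {1..p} ?N) (?N j) (\<lambda>x. x j))"
    using j by (subst integral_distr) auto
  also have "\<dots> = (\<integral>x. x \<partial>?N j)"
    using j p by (subst distr_PiM_component) auto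
  also have "\<dots> = (\<integral>x. normal_density (y * mean W j) (sd j) x * x \<partial>lborel)"
    unfolding normal_law_def by (subst integral_density) auto
  also have "\<dots> = y * mean W j"
    using normal_moment_nz_1[OF layer_sd_pos] by (rule has_bochner_integral_integral_eq)
  finally show ?thesis .
qed

lemma G_vec_square:
  assumes "w \<in> G_vec p" "j \<in> {1..p}"
  shows "(w j)\<^sup>2 = 1 / 2 ^ min j (p - 1)"
  using assms by (auto simp: G_vec_def PiE_iff power_divide dest!: bspec)

lemma fst_G_square: "W \<in> G \<Longrightarrow> j \<in> {1..p} \<Longrightarrow> (fst W j)\<^sup>2 = 1 / 2 ^ min j (p - 1)"
  by (rule G_vec_square) (auto simp: G_class_def)

lemma inv_total_perm:
  assumes "W \<in> G" "j \<in> {1..r}"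
  shows "inv (total_perm W) j \<in> {1..r}"
  using permutes_in_image[OF permutes_inv[OF perm_prod_permutes[OF assms(1) order_refl]]] assms(2) by simp

lemma mean_nonzero:
  assumes "W \<in> G" "j \<in> {1..p}"
  shows "mean W j \<noteq> 0"
proof -
  have "fst W i \<noteq> 0" if "i \<in> {1..p}" for i
    using fst_G_square[OF assms(1) that] by (metis divide_eq_0_iff power_eq_0_iff power_zero_numeral zero_neq_numeral zero_neq_one)
  moreover have "inv (total_perm W) j \<in> {1..p}" if "j \<le> r"
    using inv_total_perm[OF assms(1), of j] that assms(2) r_less by auto
  ultimately show ?thesis using assms(2) c_pos by (auto simp: layer_mean_def)
qed

text \<open>Given \<open>y\<close>, the statistic that decides on an error is a weighted sum of
  normal coordinates. The label enters once through the classifier and once through the mean of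
  \<open>x\<close>, and \<open>y * y = 1\<close>, so both labels give the same error
  probability.\<close>

lemma risk_eq:
  assumes V: "V \<in> G" and W: "W \<in> G"
  shows "risk p d \<sigma> V W =
    (1 - erf (inner_vec p (mean V) (mean W) / (sqrt 2 * sqrt (\<Sum>j\<in>{1..p}. (mean V j)\<^sup>2 * (sd j)\<^sup>2)))) / 2"
proof -
  let ?v = "sqrt (\<Sum>j\<in>{1..p}. (mean V j)\<^sup>2 * (sd j)\<^sup>2)"
  let ?e = "(1 - erf (inner_vec p (mean V) (mean W) / (sqrt 2 * ?v))) / 2"
  let ?L = "\<lambda>y. PiM {1..p} (\<lambda>j. normal_law (y * mean W j) (sd j))"
  let ?A = "{(x, y) \<in> space (data_M p). inner_vec p x (cond_mean p d \<sigma> V y) \<le> 0}"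
  have v: "?v > 0"
  proof -
    have "(\<Sum>j\<in>{1..p}. (mean V j)\<^sup>2 * (sd j)\<^sup>2) > 0"
      using r_less mean_nonzero[OF V] layer_sd_pos by (intro sum_pos mult_pos_pos) (auto simp: less_le)
    then show ?thesis by simp
  qed
  have L: "?L y \<in> space (prob_algebra (vec_M p))" for y
    by (rule PiM_normal_law_in_prob_algebra) (rule layer_sd_pos)
  have f: "(\<lambda>z. inner_vec p (fst z) (cond_mean p d \<sigma> V (snd z))) \<in> borel_measurable (data_M p)"
    unfolding inner_vec_def data_M_def
    by (intro borel_measurable_sum borel_measurable_times measurable_compose[OF measurable_fst measurable_vec_component]
        measurable_compose[OF measurable_snd measurable_label_M]) auto
  have "?A = {z \<in> space (data_M p). inner_vec p (fst z) (cond_mean p d \<sigma> V (snd z)) \<le> 0}" by auto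
  then have A: "?A \<in> sets (data_M p)"
    using borel_measurable_le[OF f borel_measurable_const[of 0]] by simp
  have slice: "(\<integral>\<^sup>+x. indicator ?A (x, y) \<partial>?L y) = ennreal ?e" if y: "y \<in> {-1, 1}" for y
  proof -
    have yy: "y * y = 1" using y by auto
    interpret P: prob_space "?L y" using L by (simp add: space_prob_algebra)
    let ?N = "normal_law (inner_vec p (mean V) (mean W)) ?v"
    interpret N: prob_space ?N by (rule prob_space_normal_law[OF v])
    have "(\<integral>\<^sup>+x. indicator ?A (x, y) \<partial>?L y) = (\<integral>\<^sup>+x. indicator {..0} (\<Sum>j\<in>{1..p}. (y * mean V j) * x j) \<partial>?L y)"
    proof (rule nn_integral_cong)
      fix x assume "x \<in> space (?L y)"
      then have "(x, y) \<in> space (data_M p)"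
        using y by (auto simp: data_M_def space_pair_measure vec_M_def space_PiM)
      moreover have "inner_vec p x (cond_mean p d \<sigma> V y) = (\<Sum>j\<in>{1..p}. (y * mean V j) * x j)"
        unfolding inner_vec_def by (intro sum.cong) (auto simp: cond_mean_eq[OF V])
      ultimately show "indicator ?A (x, y) = (indicator {..0} (\<Sum>j\<in>{1..p}. (y * mean V j) * x j) :: ennreal)"
        by (simp add: indicator_def)
    qed
    also have "\<dots> = (\<integral>\<^sup>+t. indicator {..0} t \<partial>distr (?L y) borel (\<lambda>x. \<Sum>j\<in>{1..p}. (y * mean V j) * x j))"
      by (subst nn_integral_distr) auto
    also have "distr (?L y) borel (\<lambda>x. \<Sum>j\<in>{1..p}. (y * mean V j) * x j) = ?N"
    proof (subst distr_PiM_normal_law_inner)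
      have "(y * u) * (y * v) = u * v" for u v :: real
        using yy by (metis mult.assoc mult.left_commute mult_1)
      then show "normal_law (\<Sum>i = 1..p. y * mean V i * (y * mean W i)) (sqrt (\<Sum>i = 1..p. (y * mean V i)\<^sup>2 * (sd i)\<^sup>2)) = ?N"
        by (simp only: inner_vec_def power2_eq_square)
    qed (use mean_nonzero[OF V] layer_sd_pos y r_less in auto)
    also have "(\<integral>\<^sup>+t. indicator {..0} t \<partial>?N) = ennreal (measure ?N {..0})"
      by (subst nn_integral_indicator) (simp, rule N.emeasure_eq_measure)
    also have "measure ?N {..0} = ?e" by (rule measure_normal_law_nonpos[OF v])
    finally show ?thesis .
  qed
  have e: "?e \<ge> 0" unfolding measure_normal_law_nonpos[OF v, symmetric] by simp
  have "emeasure (gauss_network p d \<sigma> W) ?A = (\<integral>\<^sup>+z. indicator ?A z \<partial>gauss_network p d \<sigma> W)"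
    using A sets_gauss_network[OF W] by (subst nn_integral_indicator) auto
  also have "\<dots> = (\<Sum>y\<in>{-1, 1}. \<integral>\<^sup>+x. indicator ?A (x, y) \<partial>?L y) / 2"
    unfolding gauss_network_eq_mixture[OF W] using A by (intro nn_integral_label_mixture L) auto
  also have "(\<Sum>y\<in>{-1, 1}. \<integral>\<^sup>+x. indicator ?A (x, y) \<partial>?L y) = (\<Sum>y\<in>{-1, 1::real}. ennreal ?e)"
    by (rule sum.cong[OF refl slice])
  also have "\<dots> / 2 = ennreal ?e"
    using mult_divide_eq_ennreal[of 2 "ennreal ?e"] by (simp add: mult.commute)
  finally have "measure (gauss_network p d \<sigma> W) ?A = ?e"
    using e by (simp add: measure_def)
  then show ?thesis
    by (simp add: risk_def sets_eq_imp_space_eq[OF sets_gauss_network[OF W]])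
qed

section \<open>Norms of the conditional means\<close>

lemma sum_mean_square_top:
  assumes W: "W \<in> G"
  shows "(\<Sum>j\<in>{1..r}. (mean W j)\<^sup>2) = 1 - 1 / 2 ^ r"
proof -
  have "(\<Sum>j\<in>{1..r}. (mean W j)\<^sup>2) = (\<Sum>j\<in>{1..r}. 1 / 2 ^ inv (total_perm W) j)"
  proof (rule sum.cong)
    fix j assume j: "j \<in> {1..r}"
    from inv_total_perm[OF W j] fst_G_square[OF W, of "inv (total_perm W) j"] j r_less
    show "(mean W j)\<^sup>2 = 1 / 2 ^ inv (total_perm W) j"
      by (auto simp: layer_mean_def min_def)
  qed simp
  also have "\<dots> = (\<Sum>j\<in>{1..r}. 1 / 2 ^ j)"
    using sum.permute[OF permutes_inv[OF perm_prod_permutes[OF W order_refl]], of "\<lambda>j. 1 / (2::real) ^ j"]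
    by (simp add: o_def)
  also have "\<dots> = 1 - 1 / 2 ^ r" by (rule sum_inverse_powers)
  finally show ?thesis .
qed

lemma sum_mean_square_bottom:
  assumes W: "W \<in> G"
  shows "(\<Sum>j\<in>{Suc r..p}. (mean W j)\<^sup>2) = c ^ (2 * d) / 2 ^ r"
proof -
  have "(\<Sum>j\<in>{Suc r..p}. (mean W j)\<^sup>2) = (\<Sum>j\<in>{Suc r..p}. c ^ (2 * d) * (1 / 2 ^ min j (p - 1)))"
    using fst_G_square[OF W]
    by (intro sum.cong) (auto simp: layer_mean_def power_mult_distrib power_mult[symmetric] mult.commute)
  also have "\<dots> = c ^ (2 * d) * (\<Sum>j\<in>{Suc r..p}. 1 / 2 ^ min j (p - 1))"
    by (simp add: sum_distrib_left)
  also have "(\<Sum>j\<in>{Suc r..p}. 1 / (2::real) ^ min j (p - 1)) = 1 / 2 ^ r"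
  proof -
    \<comment> \<open>The last coordinate repeats the square \<open>1 / 2 ^ (p - 1)\<close>; this is
      exactly the remainder of the geometric sum, so the total is \<open>1 / 2 ^ r\<close>.\<close>
    have "{Suc r..p} = insert p {Suc r..p - 1}" using r_less by auto
    then have "(\<Sum>j\<in>{Suc r..p}. 1 / (2::real) ^ min j (p - 1)) = 1 / 2 ^ (p - 1) + (\<Sum>j\<in>{Suc r..p - 1}. 1 / 2 ^ j)"
      using r_less by simp
    also have "(\<Sum>j\<in>{Suc r..p - 1}. 1 / (2::real) ^ j) = (\<Sum>j\<in>{1..p - 1}. 1 / 2 ^ j) - (\<Sum>j\<in>{1..r}. 1 / 2 ^ j)"
    proof -
      have "{1..p - 1} = {1..r} \<union> {Suc r..p - 1}" using r_less by auto
      moreover have "{1..r} \<inter> {Suc r..p - 1} = {}" by auto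
      ultimately show ?thesis by (simp add: sum.union_disjoint)
    qed
    also have "\<dots> = 1 / 2 ^ r - 1 / 2 ^ (p - 1)" unfolding sum_inverse_powers by simp
    finally show ?thesis by simp
  qed
  finally show ?thesis by simp
qed

lemma sum_split: "(\<Sum>j\<in>{1..p}. f j) = (\<Sum>j\<in>{1..r}. f j) + (\<Sum>j\<in>{Suc r..p}. f j :: real)"
proof -
  have "{1..p} = {1..r} \<union> {Suc r..p}" using r_less by auto
  moreover have "{1..r} \<inter> {Suc r..p} = {}" by auto
  ultimately show ?thesis by (simp add: sum.union_disjoint)
qed

text \<open>The value does not depend on \<open>W\<close>: all risks in the class share one
  denominator and compare through inner products alone.\<close>

lemma sum_mean_square_sd:
  assumes W: "W \<in> G"
  shows "(\<Sum>j\<in>{1..p}. (mean W j)\<^sup>2 * (sd j)\<^sup>2)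
    = \<sigma>\<^sup>2 * ((real d + 1) * (1 - 1 / 2 ^ r) + (\<Sum>k\<le>d. c ^ (2 * k)) * (c ^ (2 * d) / 2 ^ r))"
proof -
  have t: "(\<Sum>j\<in>{1..r}. (mean W j)\<^sup>2 * (sd j)\<^sup>2) = \<sigma>\<^sup>2 * (real d + 1) * (\<Sum>j\<in>{1..r}. (mean W j)\<^sup>2)"
    unfolding sum_distrib_left by (intro sum.cong) (auto simp: layer_sd_square)
  have b: "(\<Sum>j\<in>{Suc r..p}. (mean W j)\<^sup>2 * (sd j)\<^sup>2) = \<sigma>\<^sup>2 * (\<Sum>k\<le>d. c ^ (2 * k)) * (\<Sum>j\<in>{Suc r..p}. (mean W j)\<^sup>2)"
    unfolding sum_distrib_left[of "\<sigma>\<^sup>2 * (\<Sum>k\<le>d. c ^ (2 * k))"] by (intro sum.cong) (auto simp: layer_sd_square)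
  show ?thesis
    unfolding sum_split t b sum_mean_square_top[OF W] sum_mean_square_bottom[OF W]
    by algebra
qed

lemma sum_mean_square:
  "W \<in> G \<Longrightarrow> (\<Sum>j\<in>{1..p}. (mean W j)\<^sup>2) = 1 - 1 / 2 ^ r + c ^ (2 * d) / 2 ^ r"
  unfolding sum_split by (simp only: sum_mean_square_top sum_mean_square_bottom)

lemma c_power_le: "c ^ (2 * d) \<le> 1 / 4"
proof -
  have "c ^ (2 * d) \<le> c ^ 2" using c_pos c_le d_pos by (intro power_decreasing) auto
  also have "\<dots> \<le> (1 / 2)\<^sup>2" using c_pos c_le by (intro power_mono) auto
  finally show ?thesis by (simp add: power2_eq_square)
qed

text \<open>Upper variances are at least \<open>2 * \<sigma>\<^sup>2\<close> because
  \<open>d \<ge> 1\<close>. Lower ones are only bounded by \<open>\<sigma>\<^sup>2\<close> from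
  below, but there the factor \<open>c ^ (2 * d) \<le> 1 / 2\<close> of the squared means makes up
  for it.\<close>

lemma sum_mean_square_div_sd_le:
  assumes W: "W \<in> G"
  shows "(\<Sum>j\<in>{1..p}. (mean W j)\<^sup>2 / (sd j)\<^sup>2) \<le> 1 / (2 * \<sigma>\<^sup>2)"
proof -
  have "(\<Sum>j\<in>{1..r}. (mean W j)\<^sup>2 / (sd j)\<^sup>2) \<le> (\<Sum>j\<in>{1..r}. (mean W j)\<^sup>2 * (1 / (2 * \<sigma>\<^sup>2)))"
  proof (rule sum_mono)
    fix j assume "j \<in> {1..r}"
    then have "2 * \<sigma>\<^sup>2 \<le> (sd j)\<^sup>2" using d_pos sigma_pos by (simp add: layer_sd_square)
    then have "(mean W j)\<^sup>2 / (sd j)\<^sup>2 \<le> (mean W j)\<^sup>2 / (2 * \<sigma>\<^sup>2)"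
      using sigma_pos layer_sd_pos[of d j] by (intro divide_left_mono) auto
    then show "(mean W j)\<^sup>2 / (sd j)\<^sup>2 \<le> (mean W j)\<^sup>2 * (1 / (2 * \<sigma>\<^sup>2))" by simp
  qed
  also have "\<dots> = (1 - 1 / 2 ^ r) * (1 / (2 * \<sigma>\<^sup>2))"
    unfolding sum_distrib_right[symmetric] sum_mean_square_top[OF W] ..
  finally have 1: "(\<Sum>j\<in>{1..r}. (mean W j)\<^sup>2 / (sd j)\<^sup>2) \<le> (1 - 1 / 2 ^ r) * (1 / (2 * \<sigma>\<^sup>2))" .
  have "(\<Sum>j\<in>{Suc r..p}. (mean W j)\<^sup>2 / (sd j)\<^sup>2) \<le> (\<Sum>j\<in>{Suc r..p}. (mean W j)\<^sup>2 * (1 / \<sigma>\<^sup>2))"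
  proof (rule sum_mono)
    fix j assume "j \<in> {Suc r..p}"
    moreover have "(\<Sum>k\<le>d. c ^ (2 * k)) \<ge> c ^ (2 * 0)" using c_pos by (intro member_le_sum) auto
    ultimately have "\<sigma>\<^sup>2 \<le> (sd j)\<^sup>2" using sigma_pos by (simp add: layer_sd_square)
    then have "(mean W j)\<^sup>2 / (sd j)\<^sup>2 \<le> (mean W j)\<^sup>2 / \<sigma>\<^sup>2"
      using sigma_pos layer_sd_pos[of d j] by (intro divide_left_mono) auto
    then show "(mean W j)\<^sup>2 / (sd j)\<^sup>2 \<le> (mean W j)\<^sup>2 * (1 / \<sigma>\<^sup>2)" by simp
  qed
  also have "\<dots> = c ^ (2 * d) / 2 ^ r * (1 / \<sigma>\<^sup>2)"
    unfolding sum_distrib_right[symmetric] sum_mean_square_bottom[OF W] ..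
  also have "\<dots> \<le> (1 / 2) / 2 ^ r * (1 / \<sigma>\<^sup>2)"
    using c_power_le by (intro mult_right_mono divide_right_mono) auto
  finally have 2: "(\<Sum>j\<in>{Suc r..p}. (mean W j)\<^sup>2 / (sd j)\<^sup>2) \<le> 1 / 2 ^ r * (1 / (2 * \<sigma>\<^sup>2))"
    by simp
  show ?thesis
    unfolding sum_split using add_mono[OF 1 2] unfolding distrib_right[symmetric] by simp
qed

subsection \<open>Likelihood ratios with respect to pure noise\<close>

text \<open>It has the covariance common to all networks of the class, so each network differs from
  it by a shift of the mean only.\<close>

definition noise_law :: "(vec \<times> real) measure" where
  "noise_law = label_mixture p (\<lambda>_. PiM {1..p} (\<lambda>j. normal_law 0 (sd j)))"

definition likelihood_ratio :: "param \<Rightarrow> vec \<times> real \<Rightarrow> real" where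
  "likelihood_ratio W z = (\<Prod>j\<in>{1..p}. normal_likelihood_ratio (snd z * mean W j) (sd j) (fst z j))"

lemma measurable_likelihood_ratio [measurable]: "likelihood_ratio W \<in> borel_measurable (data_M p)"
proof -
  have "(\<lambda>z. fst z j) \<in> borel_measurable (data_M p)" if "j \<in> {1..p}" for j
    unfolding data_M_def by (rule measurable_compose[OF measurable_fst measurable_vec_component[OF that]])
  moreover have "snd \<in> borel_measurable (data_M p)"
    unfolding data_M_def using measurable_compose[OF measurable_snd measurable_label_M[of "\<lambda>y. y"], of "vec_M p"] by simp
  ultimately show ?thesis
    unfolding likelihood_ratio_def[abs_def] normal_likelihood_ratio_def by measurable
qed

lemma likelihood_ratio_pos: "likelihood_ratio W z > 0"
  unfolding likelihood_ratio_def by (intro prod_pos) (simp add: normal_likelihood_ratio_pos)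

lemma noise_in_prob_algebra: "PiM {1..p} (\<lambda>j. normal_law 0 (sd j)) \<in> space (prob_algebra (vec_M p))"
  by (rule PiM_normal_law_in_prob_algebra) (rule layer_sd_pos)

lemma noise_law_in_prob_algebra: "noise_law \<in> space (prob_algebra (data_M p))"
  unfolding noise_law_def by (rule label_mixture_in_prob_algebra) (rule noise_in_prob_algebra)

lemma prob_space_noise_law: "prob_space noise_law" and sets_noise_law [measurable_cong]: "sets noise_law = sets (data_M p)"
  using noise_law_in_prob_algebra by (simp_all add: space_prob_algebra)

lemma nn_integral_noise_law:
  "f \<in> borel_measurable (data_M p) \<Longrightarrow>
    (\<integral>\<^sup>+z. f z \<partial>noise_law) = (\<Sum>y\<in>{-1, 1}. \<integral>\<^sup>+x. f (x, y) \<partial>PiM {1..p} (\<lambda>j. normal_law 0 (sd j))) / 2"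
  unfolding noise_law_def by (rule nn_integral_label_mixture[OF noise_in_prob_algebra])

lemma likelihood_ratio_slice:
  "ennreal (likelihood_ratio W (x, y)) = (\<Prod>j\<in>{1..p}. ennreal (normal_likelihood_ratio (y * mean W j) (sd j) (x j)))"
  by (simp add: likelihood_ratio_def prod_ennreal normal_likelihood_ratio_pos less_imp_le)

text \<open>For each label, the product of the coordinate ratios is the density against centred
  noise; the label itself has the same law on both sides.\<close>

lemma gauss_network_density:
  assumes W: "W \<in> G"
  shows "gauss_network p d \<sigma> W = density noise_law (likelihood_ratio W)"
proof (rule measure_eqI)
  show "sets (gauss_network p d \<sigma> W) = sets (density noise_law (likelihood_ratio W))"
    by (simp add: sets_noise_law sets_gauss_network[OF W])
  fix A assume "A \<in> sets (gauss_network p d \<sigma> W)"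
  then have A[measurable]: "A \<in> sets (data_M p)" by (simp add: sets_gauss_network[OF W])
  let ?N0 = "PiM {1..p} (\<lambda>j. normal_law 0 (sd j))"
  let ?L = "\<lambda>y. PiM {1..p} (\<lambda>j. normal_law (y * mean W j) (sd j))"
  have L: "?L y \<in> space (prob_algebra (vec_M p))" for y
    by (rule PiM_normal_law_in_prob_algebra) (rule layer_sd_pos)
  have dens: "?L y = density ?N0 (\<lambda>x. ennreal (likelihood_ratio W (x, y)))" for y
  proof -
    have sf: "sigma_finite_measure (normal_law m (sd j))" for m j
      by (intro prob_space_imp_sigma_finite prob_space_normal_law layer_sd_pos)
    have "?L y = PiM {1..p} (\<lambda>j. density (normal_law 0 (sd j)) (normal_likelihood_ratio (y * mean W j) (sd j)))"
      by (intro PiM_cong) (simp_all add: density_normal_law layer_sd_pos)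
    also have "\<dots> = density ?N0 (\<lambda>x. \<Prod>j\<in>{1..p}. ennreal (normal_likelihood_ratio (y * mean W j) (sd j) (x j)))"
      by (rule PiM_density) (simp_all add: sf density_normal_law layer_sd_pos)
    finally show ?thesis by (simp only: likelihood_ratio_slice)
  qed
  have slice: "(\<lambda>x. f (x, y)) \<in> borel_measurable ?N0" if "f \<in> borel_measurable (data_M p)" "y \<in> {-1, 1}" for f :: "_ \<Rightarrow> ennreal" and y
  proof -
    have "(\<lambda>x. (x, y)) \<in> vec_M p \<rightarrow>\<^sub>M data_M p"
      unfolding data_M_def using that by (intro measurable_Pair) auto
    from measurable_compose[OF this that(1)] show ?thesis
      by (simp add: vec_M_def cong: measurable_cong_sets sets_PiM_cong)
  qed
  have "emeasure (gauss_network p d \<sigma> W) A = (\<integral>\<^sup>+z. indicator A z \<partial>gauss_network p d \<sigma> W)"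
    using A sets_gauss_network[OF W] by simp
  also have "\<dots> = (\<Sum>y\<in>{-1, 1}. \<integral>\<^sup>+x. indicator A (x, y) \<partial>?L y) / 2"
    unfolding gauss_network_eq_mixture[OF W] by (intro nn_integral_label_mixture L) auto
  also have "(\<Sum>y\<in>{-1, 1}. \<integral>\<^sup>+x. indicator A (x, y) \<partial>?L y)
     = (\<Sum>y\<in>{-1, 1}. \<integral>\<^sup>+x. ennreal (likelihood_ratio W (x, y)) * indicator A (x, y) \<partial>?N0)"
  proof (rule sum.cong)
    fix y :: real assume y: "y \<in> {-1, 1}"
    show "(\<integral>\<^sup>+x. indicator A (x, y) \<partial>?L y) = (\<integral>\<^sup>+x. ennreal (likelihood_ratio W (x, y)) * indicator A (x, y) \<partial>?N0)"
      unfolding dens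
      by (rule nn_integral_density; rule slice[OF _ y, of "\<lambda>z. ennreal (likelihood_ratio W z)"] slice[OF _ y, of "indicator A"]) measurable
  qed simp
  also have "\<dots> / 2 = (\<integral>\<^sup>+z. ennreal (likelihood_ratio W z) * indicator A z \<partial>noise_law)"
    by (rule nn_integral_noise_law[symmetric]) measurable
  also have "\<dots> = emeasure (density noise_law (likelihood_ratio W)) A"
    by (rule emeasure_density[symmetric]) measurable
  finally show "emeasure (gauss_network p d \<sigma> W) A = emeasure (density noise_law (likelihood_ratio W)) A" .
qed

text \<open>The second moment factors over the coordinates, and the label drops out on squaring the
  means.\<close>

lemma nn_integral_likelihood_ratio_square_le:
  assumes W: "W \<in> G"
  shows "(\<integral>\<^sup>+z. (ennreal (likelihood_ratio W z))\<^sup>2 \<partial>noise_law) \<le> ennreal (exp (1 / (2 * \<sigma>\<^sup>2)))"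
proof -
  let ?N0 = "PiM {1..p} (\<lambda>j. normal_law 0 (sd j))"
  let ?e = "ennreal (exp (\<Sum>j\<in>{1..p}. (mean W j)\<^sup>2 / (sd j)\<^sup>2))"
  interpret N: prob_space "normal_law 0 (sd j)" for j by (rule prob_space_normal_law) (rule layer_sd_pos)
  interpret P: product_prob_space "\<lambda>j. normal_law 0 (sd j)" by standard
  have slice: "(\<integral>\<^sup>+x. (ennreal (likelihood_ratio W (x, y)))\<^sup>2 \<partial>?N0) = ?e" if y: "y \<in> {-1, 1}" for y
  proof -
    have yy: "(y * u)\<^sup>2 = u\<^sup>2" for u using y by auto
    have "(\<integral>\<^sup>+x. (ennreal (likelihood_ratio W (x, y)))\<^sup>2 \<partial>?N0)
      = (\<integral>\<^sup>+x. (\<Prod>j\<in>{1..p}. (ennreal (normal_likelihood_ratio (y * mean W j) (sd j) (x j)))\<^sup>2) \<partial>?N0)"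
      by (simp only: likelihood_ratio_slice prod_power_distrib)
    also have "\<dots> = (\<Prod>j\<in>{1..p}. \<integral>\<^sup>+x. (ennreal (normal_likelihood_ratio (y * mean W j) (sd j) x))\<^sup>2 \<partial>normal_law 0 (sd j))"
      by (rule P.product_nn_integral_prod) auto
    also have "\<dots> = (\<Prod>j\<in>{1..p}. ennreal (exp ((mean W j)\<^sup>2 / (sd j)\<^sup>2)))"
      by (simp only: nn_integral_normal_likelihood_ratio_square[OF layer_sd_pos] yy)
    also have "\<dots> = ?e" by (simp add: prod_ennreal exp_sum)
    finally show ?thesis .
  qed
  have "(\<integral>\<^sup>+z. (ennreal (likelihood_ratio W z))\<^sup>2 \<partial>noise_law) = (\<Sum>y\<in>{-1, 1}. \<integral>\<^sup>+x. (ennreal (likelihood_ratio W (x, y)))\<^sup>2 \<partial>?N0) / 2"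
    by (rule nn_integral_noise_law) measurable
  also have "(\<Sum>y\<in>{-1, 1}. \<integral>\<^sup>+x. (ennreal (likelihood_ratio W (x, y)))\<^sup>2 \<partial>?N0) = (\<Sum>y\<in>{-1, 1::real}. ?e)"
    by (rule sum.cong[OF refl slice])
  also have "\<dots> / 2 = ?e"
    using mult_divide_eq_ennreal[of 2 ?e] by (simp add: mult.commute)
  finally show ?thesis using sum_mean_square_div_sd_le[OF W] by (simp add: ennreal_leI)
qed

text \<open>Change of measure to pure noise. By independence, \<kappa> bounds the second moment of
  the likelihood ratio of \<open>n\<close> observations.\<close>

lemma sample_event_le:
  fixes n :: nat
  assumes W: "W \<in> G" and A[measurable]: "A \<in> sets (sample_M p n)"
  defines "\<kappa> \<equiv> exp (real n / (2 * \<sigma>\<^sup>2))"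
  shows "emeasure (PiM {1..n} (\<lambda>_. gauss_network p d \<sigma> W)) A
    \<le> 1 / 4 + ennreal \<kappa> * emeasure (PiM {1..n} (\<lambda>_. noise_law)) A"
proof -
  have \<kappa>: "\<kappa> > 0" by (simp add: \<kappa>_def)
  let ?Q = "PiM {1..n} (\<lambda>_. noise_law)"
  let ?L = "\<lambda>S. \<Prod>i\<in>{1..n}. likelihood_ratio W (S i)"
  interpret N: prob_space noise_law by (rule prob_space_noise_law)
  interpret P: product_prob_space "\<lambda>_. noise_law" "{1..n}" by standard
  have sets_Q[measurable_cong]: "sets ?Q = sets (sample_M p n)"
    unfolding sample_M_def by (rule sets_PiM_cong) (simp_all add: sets_noise_law)
  have R[measurable]: "(\<lambda>S. likelihood_ratio W (S i)) \<in> borel_measurable ?Q" if "i \<in> {1..n}" for i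
  proof -
    have "likelihood_ratio W \<in> borel_measurable noise_law" by measurable
    with that show ?thesis by (intro measurable_compose[OF measurable_component_singleton])
  qed
  have L[measurable]: "?L \<in> borel_measurable ?Q" by measurable
  have Leq: "(\<Prod>i\<in>{1..n}. ennreal (likelihood_ratio W (S i))) = ennreal (?L S)" for S
    by (simp add: prod_ennreal likelihood_ratio_pos less_imp_le)
  have "PiM {1..n} (\<lambda>_. gauss_network p d \<sigma> W) = density ?Q (\<lambda>S. ennreal (?L S))"
    unfolding Leq[symmetric] gauss_network_density[OF W]
    by (rule PiM_density)
      (simp_all add: gauss_network_density[OF W, symmetric] prob_space_imp_sigma_finite
        prob_space_gauss_network[OF W] prob_space_noise_law cong: measurable_cong_sets)
  then have "emeasure (PiM {1..n} (\<lambda>_. gauss_network p d \<sigma> W)) A = (\<integral>\<^sup>+S. ennreal (?L S) * indicator A S \<partial>?Q)"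
    using A sets_Q by (simp only: emeasure_density measurable_ennreal L measurable_compose[OF L])
  \<comment> \<open>The indicator is dropped from the quadratic term, which thus costs at most 1/4
    whatever the event, and kept on the constant term. The pointwise bound comes from expanding the
    square of \<open>L - 2 * \<kappa>\<close>.\<close>
  also have "\<dots> \<le> (\<integral>\<^sup>+S. ennreal (1 / (4 * \<kappa>)) * (\<Prod>i\<in>{1..n}. (ennreal (likelihood_ratio W (S i)))\<^sup>2) + ennreal \<kappa> * indicator A S \<partial>?Q)"
  proof (rule nn_integral_mono)
    fix S
    have "0 \<le> (?L S - 2 * \<kappa>)\<^sup>2" by simp
    then have "4 * \<kappa> * ?L S \<le> (?L S)\<^sup>2 + 4 * \<kappa>\<^sup>2" by (simp add: power2_diff mult_ac)
    then have "?L S \<le> 1 / (4 * \<kappa>) * (?L S)\<^sup>2 + \<kappa>"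
      using \<kappa> by (simp add: field_simps power2_eq_square)
    then have "ennreal (?L S) \<le> ennreal (1 / (4 * \<kappa>) * (?L S)\<^sup>2 + \<kappa>)" by (rule ennreal_leI)
    also have "\<dots> = ennreal (1 / (4 * \<kappa>)) * (ennreal (?L S))\<^sup>2 + ennreal \<kappa>"
      using \<kappa> by (subst ennreal_plus, simp, simp, subst ennreal_mult)
        (simp_all add: ennreal_power prod_nonneg likelihood_ratio_pos less_imp_le)
    finally show "ennreal (?L S) * indicator A S \<le>
        ennreal (1 / (4 * \<kappa>)) * (\<Prod>i\<in>{1..n}. (ennreal (likelihood_ratio W (S i)))\<^sup>2) + ennreal \<kappa> * indicator A S"
      unfolding prod_power_distrib[symmetric] Leq by (auto simp: indicator_def)
  qed
  also have "\<dots> = ennreal (1 / (4 * \<kappa>)) * (\<integral>\<^sup>+S. (\<Prod>i\<in>{1..n}. (ennreal (likelihood_ratio W (S i)))\<^sup>2) \<partial>?Q) + ennreal \<kappa> * emeasure ?Q A"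
  proof -
    have 1: "(\<lambda>S. \<Prod>i\<in>{1..n}. (ennreal (likelihood_ratio W (S i)))\<^sup>2) \<in> borel_measurable ?Q" by measurable
    have A': "A \<in> sets ?Q" using A sets_Q by simp
    show ?thesis
      using 1 A'
      by (simp only: nn_integral_add nn_integral_cmult nn_integral_indicator
          borel_measurable_times_ennreal borel_measurable_const borel_measurable_indicator)
  qed
  also have "(\<integral>\<^sup>+S. (\<Prod>i\<in>{1..n}. (ennreal (likelihood_ratio W (S i)))\<^sup>2) \<partial>?Q)
     = (\<Prod>i\<in>{1..n}. \<integral>\<^sup>+z. (ennreal (likelihood_ratio W z))\<^sup>2 \<partial>noise_law)"
    by (rule P.product_nn_integral_prod) auto
  also have "\<dots> \<le> (\<Prod>i\<in>{1..n}. ennreal (exp (1 / (2 * \<sigma>\<^sup>2))))"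
    by (simp add: power_mono nn_integral_likelihood_ratio_square_le[OF W])
  also have "\<dots> = ennreal \<kappa>"
    by (simp add: \<kappa>_def ennreal_power exp_of_nat_mult[symmetric])
  also have "ennreal (1 / (4 * \<kappa>)) * ennreal \<kappa> = ennreal (1 / 4)"
    using \<kappa> by (simp add: ennreal_mult[symmetric])
  also have "ennreal (1 / 4) = 1 / 4"
    using divide_ennreal[of 1 4] by simp
  finally show ?thesis by (simp add: add_right_mono mult_left_mono)
qed

subsection \<open>Counting close parameters\<close>

text \<open>The threshold is the squared distance caused by flipping the sign of the last entry of \<open>w\<^sub>0\<close>,
  which is the configuration behind the constant \<open>c0\<close>.\<close>

definition close :: "param \<Rightarrow> param \<Rightarrow> bool" where
  "close V W \<longleftrightarrow> (\<Sum>j\<in>{1..p}. (mean V j - mean W j)\<^sup>2) < 4 * c ^ (2 * d) / 2 ^ (p - 1)"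

text \<open>The second, weaker bound is in terms of \<open>1 / 2 ^ r\<close>, the smallest squared
  entry of the upper block; it follows from \<open>c ^ (2 * d) \<le> 1 / 4\<close> and
  \<open>r \<le> p - 1\<close>.\<close>

lemma close_component:
  assumes "close V W" "j \<in> {1..p}"
  shows "(mean V j - mean W j)\<^sup>2 < 4 * c ^ (2 * d) / 2 ^ (p - 1)" "(mean V j - mean W j)\<^sup>2 < 1 / 2 ^ r"
proof -
  have "(mean V j - mean W j)\<^sup>2 \<le> (\<Sum>j\<in>{1..p}. (mean V j - mean W j)\<^sup>2)"
    using assms(2) by (intro member_le_sum) auto
  with assms(1) show 1: "(mean V j - mean W j)\<^sup>2 < 4 * c ^ (2 * d) / 2 ^ (p - 1)"
    by (simp add: close_def)
  also have "\<dots> \<le> 1 / 2 ^ (p - 1)"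
    using c_power_le by (intro divide_right_mono) auto
  also have "\<dots> \<le> 1 / 2 ^ r" using r_less by (intro divide_left_mono power_increasing) auto
  finally show "(mean V j - mean W j)\<^sup>2 < 1 / 2 ^ r" .
qed

text \<open>Below the upper block only signs can differ, and a flipped sign alone contributes at
  least the threshold; closeness is a strict inequality.\<close>

lemma close_bottom:
  assumes V: "V \<in> G" and W: "W \<in> G" and "close V W" and j: "j \<in> {Suc r..p}"
  shows "fst W j = fst V j"
proof (rule ccontr)
  assume ne: "fst W j \<noteq> fst V j"
  have j': "j \<in> {1..p}" using j by auto
  have "(fst W j)\<^sup>2 = (fst V j)\<^sup>2" using fst_G_square[OF V j'] fst_G_square[OF W j'] by simp
  with ne have neg: "fst W j = - fst V j" by (auto simp: power2_eq_iff)
  have "(mean V j - mean W j)\<^sup>2 = (c ^ d * 2 * fst V j)\<^sup>2"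
    using j neg by (simp add: layer_mean_def power_mult_distrib)
  also have "\<dots> = 4 * c ^ (2 * d) * (1 / 2 ^ min j (p - 1))"
    using fst_G_square[OF V j'] by (simp add: power_mult_distrib power_mult[symmetric] mult_ac)
  also have "\<dots> \<ge> 4 * c ^ (2 * d) * (1 / 2 ^ (p - 1))"
    using c_pos by (intro mult_left_mono divide_left_mono power_increasing) auto
  finally show False using close_component(1)[OF assms(3) j'] by simp
qed

lemma mean_square_top:
  assumes W: "W \<in> G" and j: "j \<in> {1..r}"
  shows "(mean W j)\<^sup>2 = 1 / 2 ^ inv (total_perm W) j"
  using inv_total_perm[OF W j] fst_G_square[OF W, of "inv (total_perm W) j"] j r_less
  by (auto simp: layer_mean_def min_def)

lemma mean_square_top_ge:
  assumes W: "W \<in> G" and j: "j \<in> {1..r}"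
  shows "(mean W j)\<^sup>2 \<ge> 1 / 2 ^ r"
  unfolding mean_square_top[OF assms] using inv_total_perm[OF assms]
  by (intro divide_left_mono power_increasing) auto

text \<open>With opposite signs the squared difference would be at least
  \<open>(mean V j)\<^sup>2\<close>, hence at least \<open>1 / 2 ^ r\<close>.\<close>

lemma close_sign:
  assumes V: "V \<in> G" and W: "W \<in> G" and "close V W" and j: "j \<in> {1..r}"
  shows "mean V j * mean W j > 0"
proof (rule ccontr)
  assume "\<not> ?thesis"
  then have "(mean V j)\<^sup>2 \<le> (mean V j - mean W j)\<^sup>2"
    using power2_diff[of "mean V j" "mean W j"] zero_le_power2[of "mean W j"] by linarith
  moreover have "j \<in> {1..p}" using j r_less by auto
  ultimately show False
    using mean_square_top_ge[OF V j] close_component(2)[OF assms(3), of j] by linarith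
qed

text \<open>At the position to which \<open>V\<close> moves entry \<open>k\<close>, the squared mean
  of \<open>V\<close> is \<open>1 / 2 ^ k\<close>. If \<open>W\<close> had another entry there,
  \<open>square_diff_ge\<close> would give a squared difference of at least
  \<open>1 / 2 ^ (k + 4)\<close>, which is too large when \<open>k + 4 \<le> r\<close>.\<close>

lemma close_total_perm:
  assumes V: "V \<in> G" and W: "W \<in> G" and "close V W" and k: "k \<in> {1..r}" "k + 4 \<le> r"
  shows "total_perm W k = total_perm V k"
proof -
  note pV = perm_prod_permutes[OF V order_refl] and pW = perm_prod_permutes[OF W order_refl]
  define i where "i = total_perm V k"
  have i: "i \<in> {1..r}" unfolding i_def using permutes_in_image[OF pV] k by blast
  then have i': "i \<in> {1..p}" using r_less by auto
  define k' where "k' = inv (total_perm W) i"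
  have mV: "(mean V i)\<^sup>2 = 1 / 2 ^ k"
    using mean_square_top[OF V i] permutes_inverses[OF pV] by (simp add: i_def)
  have mW: "(mean W i)\<^sup>2 = 1 / 2 ^ k'"
    using mean_square_top[OF W i] by (simp add: k'_def)
  have "k' = k"
  proof (rule ccontr)
    assume "k' \<noteq> k"
    have half: "2 * (1 / 2 ^ b) \<le> 1 / (2::real) ^ a" if "a < b" for a b :: nat
    proof -
      have "(2::real) ^ Suc a \<le> 2 ^ b" using that by (intro power_increasing) auto
      then show ?thesis by (simp add: field_simps)
    qed
    have "(mean V i)\<^sup>2 \<ge> 2 * (mean W i)\<^sup>2 \<or> (mean W i)\<^sup>2 \<ge> 2 * (mean V i)\<^sup>2"
      unfolding mV mW using \<open>k' \<noteq> k\<close> half[of k k'] half[of k' k] by (cases "k' < k") auto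
    from square_diff_ge[OF this] have "(mean V i - mean W i)\<^sup>2 \<ge> 1 / 2 ^ k / 16" by (simp add: mV)
    also have "1 / (2::real) ^ k / 16 = 1 / 2 ^ (k + 4)" by (simp add: power_add)
    also have "\<dots> \<ge> 1 / 2 ^ r" using k by (intro divide_left_mono power_increasing) auto
    finally show False using close_component(2)[OF assms(3) i'] by simp
  qed
  then show ?thesis using permutes_inverses[OF pW, of i] by (simp add: k'_def i_def)
qed

text \<open>A close \<open>W\<close> is encoded by its first \<open>d - 1\<close> layers and its
  total permutation relative to that of \<open>V\<close>. The signs need no code, as they can be
  read off from \<open>V\<close>.\<close>

lemma card_close_le:
  assumes V: "V \<in> G"
  shows "card {W \<in> G. close V W} \<le> card (G_mat p r c) ^ (d - 1) * fact (min r 4)"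
proof -
  note pV = perm_prod_permutes[OF V order_refl]
  \<comment> \<open>The last \<open>min r 4\<close> indices, the only ones that the relative
    permutation can move.\<close>
  define S where "S = {k \<in> {1..r}. r < k + 4}"
  let ?T = "PiE {1..<d} (\<lambda>_. G_mat p r c) \<times> {\<pi>. \<pi> permutes S}"
  \<comment> \<open>The last layer of \<open>W\<close> is recovered from the other ones and the total permutation.\<close>
  define \<Phi> where "\<Phi> W = (restrict (snd W) {1..<d}, inv (total_perm V) \<circ> total_perm W)" for W
  have "S = {Suc r - min r 4..r}" by (auto simp: S_def)
  then have cS: "card S = min r 4" by simp
  have "inj_on \<Phi> {W \<in> G. close V W}"
  proof (rule inj_onI)
    fix W W' assume "W \<in> {W \<in> G. close V W}" "W' \<in> {W \<in> G. close V W}" and eq: "\<Phi> W = \<Phi> W'"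
    then have W: "W \<in> G" "close V W" and W': "W' \<in> G" "close V W'" by auto
    have snd_eq: "snd W i = snd W' i" if "i \<in> {1..<d}" for i
      using fun_cong[OF arg_cong[OF eq, of fst], of i] that by (simp add: \<Phi>_def)
    have "total_perm V (inv (total_perm V) (total_perm W j)) = total_perm V (inv (total_perm V) (total_perm W' j))" for j
      using fun_cong[OF arg_cong[OF eq, of snd], of j] by (simp add: \<Phi>_def)
    then have tot: "total_perm W = total_perm W'"
      unfolding permutes_inverses[OF pV] by (intro ext) simp
    have pp: "i < d \<Longrightarrow> perm_prod p r c W i = perm_prod p r c W' i" for i
      by (induction i) (simp_all add: snd_eq)
    obtain e where e: "d = Suc e" using d_pos by (cases d) auto
    have "block_perm p r c (snd W d) = block_perm p r c (snd W' d)"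
    proof
      fix j
      have pe: "perm_prod p r c W e permutes {1..r}" by (rule perm_prod_permutes) (use W e in auto)
      obtain j' where j': "j = perm_prod p r c W e j'" using permutes_inverses(1)[OF pe, of j] by metis
      show "block_perm p r c (snd W d) j = block_perm p r c (snd W' d) j"
        using fun_cong[OF tot, of j'] pp[of e] by (simp add: e j')
    qed
    then have "snd W d = snd W' d"
      using block_mat_block_perm[OF G_snd] W W' d_pos by (metis atLeastAtMost_iff order_refl)
    moreover have "snd W \<in> extensional {1..d}" "snd W' \<in> extensional {1..d}"
      using W W' by (auto simp: G_class_def PiE_def)
    ultimately have s: "snd W = snd W'"
      using snd_eq by (intro extensionalityI[of _ "{1..d}"]) (auto simp: le_less)
    have "fst W j = fst W' j" if j: "j \<in> {1..p}" for j
    proof (cases "j \<le> r")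
      case False
      then show ?thesis using close_bottom[OF V W, of j] close_bottom[OF V W', of j] j by simp
    next
      case True
      \<comment> \<open>Since the total permutations agree, the entry at \<open>j\<close> of either
        vector arrives at the same position \<open>i\<close>, where both means have the sign of
        \<open>mean V i\<close>.\<close>
      define i where "i = total_perm W j"
      have pW: "total_perm W permutes {1..r}" by (rule perm_prod_permutes) (use W in auto)
      have i: "i \<in> {1..r}" unfolding i_def using permutes_in_image[OF pW] True j by auto
      have "mean W i = fst W j" "mean W' i = fst W' j"
        using i permutes_inverses[OF pW] by (simp_all add: layer_mean_def i_def tot[symmetric])
      moreover have "(fst W j)\<^sup>2 = (fst W' j)\<^sup>2"
        using fst_G_square[OF W(1) j] fst_G_square[OF W'(1) j] by simp
      ultimately show ?thesis
        using close_sign[OF V W i] close_sign[OF V W' i] by (auto simp: power2_eq_iff)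
    qed
    moreover have "fst W \<in> extensional {1..p}" "fst W' \<in> extensional {1..p}"
      using W W' by (auto simp: G_class_def G_vec_def PiE_def)
    ultimately have "fst W = fst W'" by (intro extensionalityI[of _ "{1..p}"])
    with s show "W = W'" by (simp add: prod_eq_iff)
  qed
  moreover have "\<Phi> ` {W \<in> G. close V W} \<subseteq> ?T"
  proof (rule image_subsetI)
    fix W assume "W \<in> {W \<in> G. close V W}"
    then have W: "W \<in> G" "close V W" by auto
    have "inv (total_perm V) \<circ> total_perm W permutes {1..r}"
      by (intro permutes_compose permutes_inv pV perm_prod_permutes) (use W in auto)
    then have "inv (total_perm V) \<circ> total_perm W permutes S"
    proof (rule permutes_superset)
      fix k assume "k \<in> {1..r} - S"
      then have "total_perm W k = total_perm V k"
        by (intro close_total_perm[OF V W]) (auto simp: S_def)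
      then have "(inv (total_perm V) \<circ> total_perm W) k = inv (total_perm V) (total_perm V k)"
        by (simp only: o_apply)
      then show "(inv (total_perm V) \<circ> total_perm W) k = k"
        by (simp only: permutes_inverses(2)[OF pV])
    qed
    then show "\<Phi> W \<in> ?T" using W G_snd by (auto simp: \<Phi>_def)
  qed
  moreover have "finite S" by (simp add: S_def)
  then have "finite ?T"
    by (intro finite_cartesian_product finite_PiE finite_G_mat finite_permutations) auto
  ultimately have "card {W \<in> G. close V W} \<le> card ?T" by (rule card_inj_on_le)
  also have "card ?T = card (G_mat p r c) ^ (d - 1) * fact (min r 4)"
    using \<open>finite S\<close> cS by (simp add: card_cartesian_product card_PiE card_permutations)
  finally show ?thesis .
qed

text \<open>With \<open>q = min r 4\<close>, \<open>B = q!\<close> and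
  \<open>m = 2 ^ p * r! / 4\<close>, the hypothesis says \<open>\<kappa> ^ 8 \<le> m\<close>. It
  remains to see \<open>B ^ 8 \<le> m ^ 7\<close>: this follows from
  \<open>B \<le> 2 ^ (7 * (q - 1))\<close> and \<open>B * 2 ^ (q - 1) \<le> m\<close>, the latter
  because \<open>q - 1 \<le> p - 2\<close>.\<close>

lemma close_bound:
  assumes n: "real n \<le> \<sigma>\<^sup>2 * (((\<Sum>i\<in>{1..r}. ln (real i)) + real p * ln 2 - ln 4) / 4)"
  shows "4 * exp (real n / (2 * \<sigma>\<^sup>2)) * fact (min r 4) \<le> 2 ^ p * fact r"
proof -
  define \<kappa> where "\<kappa> = exp (real n / (2 * \<sigma>\<^sup>2))"
  define B :: real where "B = fact (min r 4)"
  define m :: real where "m = 2 ^ p * fact r / 4"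
  have m: "m > 0" by (simp add: m_def)
  have lnf: "(\<Sum>i\<in>{1..k}. ln (real i)) = ln (fact k)" for k
    by (induction k) (auto simp: ln_mult add.commute)
  have "ln m = (\<Sum>i\<in>{1..r}. ln (real i)) + real p * ln 2 - ln 4"
    by (simp only: lnf) (simp add: m_def ln_mult ln_div ln_realpow)
  then have "4 * real n \<le> ln m * \<sigma>\<^sup>2" using n by (simp add: mult.commute)
  then have "4 * (real n / \<sigma>\<^sup>2) \<le> ln m"
    using sigma_pos by (simp add: pos_divide_le_eq)
  moreover have "\<kappa> ^ 8 = exp (4 * (real n / \<sigma>\<^sup>2))"
    by (simp add: \<kappa>_def exp_of_nat_mult[symmetric])
  ultimately have \<kappa>8: "\<kappa> ^ 8 \<le> m" using m by (metis exp_le_cancel_iff exp_ln)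
  have "min r 4 \<in> {1, 2, 3, 4}" using r_pos by auto
  \<comment> \<open>The four cases compare 1, 2, 6, 24 with \<open>1\<close>, \<open>2 ^ 7\<close>,
    \<open>2 ^ 14\<close>, \<open>2 ^ 21\<close>.\<close>
  then have B_le: "B \<le> (2 ^ (min r 4 - 1)) ^ 7" by (auto simp: B_def fact_numeral)
  have "B * 2 ^ (min r 4 - 1) \<le> m"
  proof -
    have "B \<le> fact r" unfolding B_def by (rule fact_mono) simp
    moreover have "(2::real) ^ (min r 4 - 1) \<le> 2 ^ (p - 2)" using r_less by (intro power_increasing) auto
    moreover have "(2::real) ^ p = 4 * 2 ^ (p - 2)"
    proof -
      have "p = 2 + (p - 2)" using r_less r_pos by simp
      then have "(2::real) ^ p = 2 ^ (2 + (p - 2))" by (rule arg_cong)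
      then show ?thesis by (simp only: power_add) simp
    qed
    ultimately show ?thesis
      unfolding m_def by (simp add: mult_mono mult.commute B_def)
  qed
  then have "(B * 2 ^ (min r 4 - 1)) ^ 7 \<le> m ^ 7" by (intro power_mono) (auto simp: B_def)
  then have "B ^ 7 * (2 ^ (min r 4 - 1)) ^ 7 \<le> m ^ 7" by (simp only: power_mult_distrib)
  moreover have "B ^ 7 * B \<le> B ^ 7 * (2 ^ (min r 4 - 1)) ^ 7"
    using B_le by (intro mult_left_mono) (auto simp: B_def)
  ultimately have "B ^ 8 \<le> m ^ 7" by (simp add: power_Suc2[symmetric] eval_nat_numeral)
  then have "(\<kappa> * B) ^ 8 \<le> m * m ^ 7"
    unfolding power_mult_distrib using \<kappa>8 m by (intro mult_mono) (auto simp: B_def)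
  then have "(\<kappa> * B) ^ 8 \<le> m ^ 8" by (simp add: eval_nat_numeral)
  \<comment> \<open>The rule has exponent \<open>Suc n\<close>, hence 7 for an eighth root.\<close>
  then have "\<kappa> * B \<le> m" by (rule power_le_imp_le_base[where n=7, simplified]) (use m in simp)
  then show ?thesis by (simp add: \<kappa>_def B_def m_def field_simps)
qed

subsection \<open>Success probability of a decoder\<close>

text \<open>All means in the class have equal norm, so the inner product of two of them is the
  squared norm minus half the squared distance. A distance above the threshold pushes it below the
  numerator of \<open>c0\<close>, while the truth itself attains that of \<open>c1\<close>;
  monotonicity of \<open>erf\<close> concludes.\<close>

lemma excess_risk_ge:
  assumes V: "V \<in> G" and W: "W \<in> G" and "\<not> close V W"
    and c0: "c0 = (1 - 1 / 2 ^ r + c ^ (2 * d) * (1 / 2 ^ r - 1 / 2 ^ (p - 2))) / (sqrt 2 * v)"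
    and c1: "c1 = (1 - 1 / 2 ^ r + c ^ (2 * d) / 2 ^ r) / (sqrt 2 * v)"
    and v: "v = sqrt (\<sigma>\<^sup>2 * ((real d + 1) * (1 - 1 / 2 ^ r) + (\<Sum>k\<le>d. c ^ (2 * k)) * (c ^ (2 * d) / 2 ^ r)))"
  shows "excess_risk p d \<sigma> V W \<ge> (erf c1 - erf c0) / 2"
proof -
  have sd: "sqrt (\<Sum>j\<in>{1..p}. (mean U j)\<^sup>2 * (sd j)\<^sup>2) = v" if "U \<in> G" for U
    by (simp only: sum_mean_square_sd[OF that] v)
  have "v \<ge> 0" unfolding sd[OF V, symmetric] by (intro real_sqrt_ge_zero sum_nonneg) simp
  then have v_nonneg: "sqrt 2 * v \<ge> 0" by simp
  have c1': "inner_vec p (mean W) (mean W) / (sqrt 2 * v) = c1"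
    using sum_mean_square[OF W] by (simp add: inner_vec_def power2_eq_square c1)
  have "(\<Sum>j\<in>{1..p}. (mean V j - mean W j)\<^sup>2)
     = (\<Sum>j\<in>{1..p}. (mean V j)\<^sup>2) + (\<Sum>j\<in>{1..p}. (mean W j)\<^sup>2) - 2 * inner_vec p (mean V) (mean W)"
    by (simp add: power2_diff inner_vec_def sum.distrib sum_subtractf sum_distrib_left mult.assoc)
  then have S: "(\<Sum>j\<in>{1..p}. (mean V j - mean W j)\<^sup>2)
     = (1 - 1 / 2 ^ r + c ^ (2 * d) / 2 ^ r) + (1 - 1 / 2 ^ r + c ^ (2 * d) / 2 ^ r) - 2 * inner_vec p (mean V) (mean W)"
    by (simp only: sum_mean_square[OF V] sum_mean_square[OF W])
  have "s = a + a - 2 * x \<Longrightarrow> 2 * x = 2 * a - s" for s a x :: real by simp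
  from this[OF S] have "2 * inner_vec p (mean V) (mean W)
     = 2 * (1 - 1 / 2 ^ r + c ^ (2 * d) / 2 ^ r) - (\<Sum>j\<in>{1..p}. (mean V j - mean W j)\<^sup>2)" .
  also have "\<dots> \<le> 2 * (1 - 1 / 2 ^ r + c ^ (2 * d) / 2 ^ r) - 4 * c ^ (2 * d) / 2 ^ (p - 1)"
    using \<open>\<not> close V W\<close> by (simp add: close_def)
  \<comment> \<open>Half of this quantity is the gap between the numerators of \<open>c1\<close> and
    \<open>c0\<close>.\<close>
  also have "4 * c ^ (2 * d) / 2 ^ (p - 1) = 2 * (c ^ (2 * d) / 2 ^ (p - 2))"
  proof -
    have "(2::real) ^ (p - 1) = 2 ^ Suc (p - 2)" using r_less r_pos by (intro arg_cong[where f="\<lambda>k. 2 ^ k"]) simp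
    then show ?thesis by simp
  qed
  finally have "inner_vec p (mean V) (mean W) \<le> 1 - 1 / 2 ^ r + c ^ (2 * d) * (1 / 2 ^ r - 1 / 2 ^ (p - 2))"
    by (simp add: algebra_simps)
  then have "inner_vec p (mean V) (mean W) / (sqrt 2 * v) \<le> c0"
    unfolding c0 using v_nonneg by (rule divide_right_mono)
  then have "erf (inner_vec p (mean V) (mean W) / (sqrt 2 * v)) \<le> erf c0" by (rule erf_mono)
  then show ?thesis
    unfolding excess_risk_def risk_eq[OF V W] risk_eq[OF W W] sd[OF V] sd[OF W] c1' by (simp add: field_simps)
qed

section \<open>The uniform prior and the joint law\<close>

lemma G_nonempty: "G \<noteq> {}"
  using card_G_class[of p d r c] card_G_mat[of r p c] r_less by auto

lemma G_prior_in_prob_algebra: "G_prior p d r c \<in> space (prob_algebra (param_M p d))"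
proof -
  have "(\<lambda>W. W) \<in> uniform_count_measure G \<rightarrow>\<^sub>M param_M p d"
    using G_subset_space by (auto simp: measurable_def space_uniform_count_measure sets_uniform_count_measure)
  then show ?thesis
    unfolding G_prior_def space_prob_algebra
    using prob_space_uniform_count_measure[OF finite_G_class G_nonempty]
    by (auto intro: prob_space.prob_space_distr)
qed

lemma nn_integral_G_prior:
  assumes "f \<in> borel_measurable (param_M p d)"
  shows "(\<integral>\<^sup>+W. f W \<partial>G_prior p d r c) = (\<Sum>W\<in>G. f W) / of_nat (card G)"
proof -
  have "(\<lambda>W. W) \<in> uniform_count_measure G \<rightarrow>\<^sub>M param_M p d"
    using G_subset_space by (auto simp: measurable_def space_uniform_count_measure sets_uniform_count_measure)
  then show ?thesis
    unfolding G_prior_def using assms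
    by (simp add: nn_integral_distr nn_integral_uniform_count_measure finite_G_class)
qed

abbreviation "class_law n \<equiv> joint_law p d n (G_prior p d r c) (gauss_network p d \<sigma>)"

lemma class_law_in_prob_algebra: "class_law n \<in> space (prob_algebra (param_M p d \<Otimes>\<^sub>M sample_M p n))"
  unfolding joint_law_def
  using prob_space_bind'[OF G_prior_in_prob_algebra measurable_joint_kernel[OF measurable_gauss_network[OF sigma_pos]]]
    sets_bind'[OF G_prior_in_prob_algebra measurable_joint_kernel[OF measurable_gauss_network[OF sigma_pos]]]
  by (simp add: space_prob_algebra)

lemma emeasure_class_law:
  assumes X: "X \<in> sets (param_M p d \<Otimes>\<^sub>M sample_M p n)"
  shows "emeasure (class_law n) X = (\<Sum>W\<in>G. emeasure (PiM {1..n} (\<lambda>_. gauss_network p d \<sigma> W)) (Pair W -` X)) / of_nat (card G)"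
proof -
  let ?K = "\<lambda>W. distr (PiM {1..n} (\<lambda>_. gauss_network p d \<sigma> W)) (param_M p d \<Otimes>\<^sub>M sample_M p n) (\<lambda>S. (W, S))"
  note K = measurable_joint_kernel[OF measurable_gauss_network[OF sigma_pos, of p d], of n]
  have "emeasure (class_law n) X = (\<integral>\<^sup>+W. emeasure (?K W) X \<partial>G_prior p d r c)"
    unfolding joint_law_def by (rule emeasure_bind_prob_algebra[OF G_prior_in_prob_algebra K X])
  also have "\<dots> = (\<Sum>W\<in>G. emeasure (?K W) X) / of_nat (card G)"
    by (rule nn_integral_G_prior) (rule measurable_emeasure_kernel[OF measurable_prob_algebraD[OF K] X])
  also have "(\<Sum>W\<in>G. emeasure (?K W) X) = (\<Sum>W\<in>G. emeasure (PiM {1..n} (\<lambda>_. gauss_network p d \<sigma> W)) (Pair W -` X))"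
  proof (rule sum.cong)
    fix W assume W: "W \<in> G"
    have sets: "sets (PiM {1..n} (\<lambda>_. gauss_network p d \<sigma> W)) = sets (sample_M p n)"
      unfolding sample_M_def by (rule sets_PiM_cong) (simp_all add: sets_gauss_network[OF W])
    have "(\<lambda>S. (W, S)) \<in> sample_M p n \<rightarrow>\<^sub>M param_M p d \<Otimes>\<^sub>M sample_M p n"
      using W G_subset_space by (intro measurable_Pair1') auto
    then have "(\<lambda>S. (W, S)) \<in> PiM {1..n} (\<lambda>_. gauss_network p d \<sigma> W) \<rightarrow>\<^sub>M param_M p d \<Otimes>\<^sub>M sample_M p n"
      by (simp only: measurable_cong_sets[OF sets refl])
    from emeasure_distr[OF this X]
    have "emeasure (?K W) X = emeasure (PiM {1..n} (\<lambda>_. gauss_network p d \<sigma> W)) (Pair W -` X \<inter> space (sample_M p n))"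
      by (simp only: sets_eq_imp_space_eq[OF sets])
    also have "Pair W -` X \<inter> space (sample_M p n) = Pair W -` X"
      using sets.sets_into_space[OF X] by (auto simp: space_pair_measure)
    finally show "emeasure (?K W) X = emeasure (PiM {1..n} (\<lambda>_. gauss_network p d \<sigma> W)) (Pair W -` X)" .
  qed simp
  finally show ?thesis .
qed

lemma class_law_in_joint_laws: "class_law n \<in> joint_laws p d n"
  unfolding joint_laws_def
  using G_prior_in_prob_algebra measurable_gauss_network[OF sigma_pos] gauss_network_in_network_laws[OF sigma_pos]
  by blast

text \<open>Under pure noise the sample does not depend on the truth, so the success probabilities
  summed over \<open>W\<close> are the expected number of parameters in the event for a given
  sample, each of them close to \<open>f S\<close>. Changing the measure adds the quarter from
  \<open>sample_event_le\<close>.\<close>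

lemma measure_close_le_half:
  assumes n: "real n \<le> \<sigma>\<^sup>2 * (((\<Sum>i\<in>{1..r}. ln (real i)) + real p * ln 2 - ln 4) / 4)"
    and X: "X \<in> sets (param_M p d \<Otimes>\<^sub>M sample_M p n)"
    and f: "f \<in> space (sample_M p n) \<rightarrow> G"
    and close: "\<And>W S. W \<in> G \<Longrightarrow> (W, S) \<in> X \<Longrightarrow> close (f S) W"
  shows "measure (class_law n) X \<le> 1 / 2"
proof -
  interpret L: prob_space "class_law n" using class_law_in_prob_algebra by (simp add: space_prob_algebra)
  let ?\<kappa> = "exp (real n / (2 * \<sigma>\<^sup>2))"
  let ?Q = "PiM {1..n} (\<lambda>_. noise_law)"
  let ?C = "card (G_mat p r c) ^ (d - 1) * fact (min r 4) :: nat"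
  interpret Q: prob_space ?Q by (rule prob_space_PiM) (rule prob_space_noise_law)
  have sets_Q: "sets ?Q = sets (sample_M p n)"
    unfolding sample_M_def by (rule sets_PiM_cong) (simp_all add: sets_noise_law)
  have slice: "Pair W -` X \<in> sets (sample_M p n)" for W by (rule sets_Pair1[OF X])
  have "(\<Sum>W\<in>G. emeasure ?Q (Pair W -` X)) = (\<Sum>W\<in>G. \<integral>\<^sup>+S. indicator (Pair W -` X) S \<partial>?Q)"
    using slice sets_Q by (intro sum.cong) simp_all
  \<comment> \<open>Sum and integral may be exchanged because \<open>?Q\<close> is the same measure
    for all \<open>W\<close>.\<close>
  also have "\<dots> = (\<integral>\<^sup>+S. (\<Sum>W\<in>G. indicator (Pair W -` X) S) \<partial>?Q)"
    using slice sets_Q by (intro nn_integral_sum[symmetric] borel_measurable_indicator) simp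
  also have "\<dots> \<le> (\<integral>\<^sup>+S. of_nat ?C \<partial>?Q)"
  proof (rule nn_integral_mono)
    fix S assume "S \<in> space ?Q"
    then have S: "f S \<in> G" using f sets_eq_imp_space_eq[OF sets_Q] by auto
    have "(\<Sum>W\<in>G. indicator (Pair W -` X) S :: ennreal) = of_nat (card {W \<in> G. (W, S) \<in> X})"
      using finite_G_class by (simp add: indicator_def sum.If_cases Int_def)
    also have "card {W \<in> G. (W, S) \<in> X} \<le> card {W \<in> G. close (f S) W}"
      using close finite_G_class by (intro card_mono) auto
    also have "\<dots> \<le> ?C" by (rule card_close_le[OF S])
    finally show "(\<Sum>W\<in>G. indicator (Pair W -` X) S :: ennreal) \<le> of_nat ?C" by simp
  qed
  also have "\<dots> = of_nat ?C"
    by (simp only: nn_integral_const Q.emeasure_space_1 mult_1_right)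
  finally have count: "(\<Sum>W\<in>G. emeasure ?Q (Pair W -` X)) \<le> of_nat ?C" .
  have "(\<Sum>W\<in>G. emeasure (PiM {1..n} (\<lambda>_. gauss_network p d \<sigma> W)) (Pair W -` X))
    \<le> (\<Sum>W\<in>G. 1 / 4 + ennreal ?\<kappa> * emeasure ?Q (Pair W -` X))"
    by (intro sum_mono sample_event_le slice)
  also have "\<dots> = of_nat (card G) * (1 / 4) + ennreal ?\<kappa> * (\<Sum>W\<in>G. emeasure ?Q (Pair W -` X))"
    by (simp add: sum.distrib sum_distrib_left)
  also have "\<dots> \<le> of_nat (card G) * (1 / 4) + ennreal ?\<kappa> * of_nat ?C"
    by (intro add_left_mono mult_left_mono count) simp
  also have "\<dots> = ennreal (real (card G) * (1 / 4) + ?\<kappa> * real ?C)"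
  proof -
    have "ennreal (real (card G) * (1 / 4)) = of_nat (card G) * (1 / 4)"
      using divide_ennreal[of 1 4] by (subst ennreal_mult) (simp_all add: ennreal_of_nat_eq_real_of_nat)
    moreover have "ennreal (?\<kappa> * real ?C) = ennreal ?\<kappa> * of_nat ?C"
      by (subst ennreal_mult) (simp_all only: ennreal_of_nat_eq_real_of_nat exp_ge_zero of_nat_0_le_iff)
    ultimately show ?thesis by (subst ennreal_plus) simp_all
  qed
  \<comment> \<open>One factor \<open>r!\<close> is split off \<open>card G\<close>; the remaining
    power \<open>d - 1\<close> of \<open>card (G_mat p r c)\<close> is the one in \<open>?C\<close>,
    and \<open>close_bound\<close> yields the second quarter.\<close>
  also have "real (card G) * (1 / 4) + ?\<kappa> * real ?C \<le> real (card G) * (1 / 2)"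
  proof -
    obtain e where e: "d = Suc e" using d_pos by (cases d) auto
    have "4 * (?\<kappa> * real ?C) = 4 * ?\<kappa> * fact (min r 4) * real (card (G_mat p r c)) ^ (d - 1)"
      by (simp add: mult_ac)
    also have "\<dots> \<le> 2 ^ p * fact r * real (card (G_mat p r c)) ^ (d - 1)"
      by (intro mult_right_mono close_bound[OF n]) simp
    also have "\<dots> = real (card G)"
      using card_G_mat[of r p c] r_less by (simp add: card_G_class e mult_ac)
    finally show ?thesis by simp
  qed
  finally have le: "(\<Sum>W\<in>G. emeasure (PiM {1..n} (\<lambda>_. gauss_network p d \<sigma> W)) (Pair W -` X)) \<le> ennreal (real (card G) * (1 / 2))"
    by (simp add: ennreal_leI)
  have cG: "real (card G) > 0" using G_nonempty finite_G_class by (simp add: card_gt_0_iff)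
  have "emeasure (class_law n) X \<le> ennreal (real (card G) * (1 / 2)) / of_nat (card G)"
    unfolding emeasure_class_law[OF X] by (rule divide_right_mono_ennreal[OF le])
  also have "\<dots> = ennreal (1 / 2)"
    using cG by (simp add: ennreal_of_nat_eq_real_of_nat divide_ennreal)
  finally have "ennreal (measure (class_law n) X) \<le> ennreal (1 / 2)" unfolding L.emeasure_eq_measure .
  then show ?thesis by (subst (asm) ennreal_le_iff) simp_all
qed

text \<open>The complement of the event in \<open>xi2\<close> is an excess risk below the threshold,
  which by \<open>excess\<close> happens only for close parameters.\<close>

lemma xi2_ge_half:
  assumes n: "real n \<le> \<sigma>\<^sup>2 * (((\<Sum>i\<in>{1..r}. ln (real i)) + real p * ln 2 - ln 4) / 4)"
    and excess: "\<And>V W. V \<in> G \<Longrightarrow> W \<in> G \<Longrightarrow> \<not> close V W \<Longrightarrow> excess_risk p d \<sigma> V W \<ge> (erf c1 - erf c0) / 2"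
    and f: "f \<in> decoders p d n G"
  shows "xi2 p d \<sigma> c0 c1 f (class_law n) \<ge> 1 / 2"
proof -
  interpret L: prob_space "class_law n" using class_law_in_prob_algebra by (simp add: space_prob_algebra)
  have sets_law: "sets (class_law n) = sets (param_M p d \<Otimes>\<^sub>M sample_M p n)"
    using class_law_in_prob_algebra by (simp add: space_prob_algebra)
  note space_law = sets_eq_imp_space_eq[OF sets_law]
  have fm: "f \<in> sample_M p n \<rightarrow>\<^sub>M param_M p d" and fG: "f \<in> space (sample_M p n) \<rightarrow> G"
    using f by (auto simp: decoders_def)
  let ?M = "param_M p d \<Otimes>\<^sub>M sample_M p n"
  let ?X = "{z \<in> space ?M. excess_risk p d \<sigma> (f (snd z)) (fst z) < (erf c1 - erf c0) / 2}"
  have "(\<lambda>z. (f (snd z), fst z)) \<in> ?M \<rightarrow>\<^sub>M param_M p d \<Otimes>\<^sub>M param_M p d"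
    by (intro measurable_Pair measurable_compose[OF measurable_snd fm] measurable_fst)
  from measurable_compose[OF this measurable_excess_risk[OF sigma_pos]]
  have "(\<lambda>z. excess_risk p d \<sigma> (f (snd z)) (fst z)) \<in> borel_measurable ?M" by simp
  then have X: "?X \<in> sets ?M" by (intro borel_measurable_less borel_measurable_const)
  have "measure (class_law n) ?X \<le> 1 / 2"
  proof (rule measure_close_le_half[OF n X fG])
    fix W S assume W: "W \<in> G" and "(W, S) \<in> ?X"
    then have S: "S \<in> space (sample_M p n)" and less: "excess_risk p d \<sigma> (f S) W < (erf c1 - erf c0) / 2"
      by (auto simp: space_pair_measure)
    have "f S \<in> G" using fG S by auto
    from excess[OF this W] less show "close (f S) W" by (meson not_le)
  qed
  moreover have "measure (class_law n) (space (class_law n) - ?X) = 1 - measure (class_law n) ?X"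
    using X sets_law by (intro L.prob_compl) simp
  moreover have "space (class_law n) - ?X = {(W, S) \<in> space (class_law n). excess_risk p d \<sigma> (f S) W \<ge> (erf c1 - erf c0) / 2}"
    unfolding space_law by auto
  ultimately show ?thesis by (simp add: xi2_def)
qed

text \<open>Constant decoders exist, so the real infimum over decoders is taken over a nonempty
  set.\<close>

lemma decoders_nonempty: "decoders p d n G \<noteq> {}"
proof -
  obtain W where "W \<in> G" using G_nonempty by auto
  then have "(\<lambda>_. W) \<in> decoders p d n G" using G_subset_space by (auto simp: decoders_def)
  then show ?thesis by auto
qed

end

theorem theorem3p3:
  fixes d p r n :: nat and \<sigma> c c0 c1 :: real
  assumes "d \<ge> 1" and "p \<ge> 2" and "1 \<le> r" and "r \<le> p - 1" and "\<sigma> > 0"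
    and c_eq: "c = 1 / (real p - real r + 1)"
    and c0_eq: "c0 = (1 - 1 / 2 ^ r + c ^ (2 * d) * (1 / 2 ^ r - 1 / 2 ^ (p - 2))) /
        (\<sigma> * sqrt (2 * ((real d + 1) * (1 - 1 / 2 ^ r) +
           (1 - c ^ (2 * (d + 1))) / (1 - c ^ 2) * (c ^ (2 * d) / 2 ^ r))))"
    and c1_eq: "c1 = (1 - 1 / 2 ^ r + c ^ (2 * d) / 2 ^ r) /
        (\<sigma> * sqrt (2 * ((real d + 1) * (1 - 1 / 2 ^ r) +
           (1 - c ^ (2 * (d + 1))) / (1 - c ^ 2) * (c ^ (2 * d) / 2 ^ r))))"
    and n_le: "real n \<le> \<sigma>\<^sup>2 * (((\<Sum>i\<in>{1..r}. ln (real i)) + real p * ln 2 - ln 4) / 4)"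
  shows "G_joint_laws p d r c \<sigma> n \<subseteq> joint_laws p d n \<and>
    (INF f\<in>decoders p d n (G_class p d r c). SUP P\<in>G_joint_laws p d r c \<sigma> n. xi2 p d \<sigma> c0 c1 f P)
      \<ge> 1 / 2"
proof -
  have "real r + 1 \<le> real p" using assms(2,4) by linarith
  then have c: "0 < c" "c \<le> 1 / 2" unfolding c_eq by (auto simp: field_simps)
  interpret backwards_class d p r \<sigma> c
    using assms(1-5) c by unfold_locales auto
  define v where "v = sqrt (\<sigma>\<^sup>2 * ((real d + 1) * (1 - 1 / 2 ^ r) + (\<Sum>k\<le>d. c ^ (2 * k)) * (c ^ (2 * d) / 2 ^ r)))"
  \<comment> \<open>This allows the geometric sum in the variance to be put into the closed form
    used in \<open>c0\<close> and \<open>c1\<close>.\<close>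
  have "c\<^sup>2 \<noteq> 1" using c power2_eq_1_iff[of c] by auto
  then have "(\<Sum>k\<le>d. (c\<^sup>2) ^ k) = (1 - (c\<^sup>2) ^ Suc d) / (1 - c\<^sup>2)"
    by (simp only: sum_gp0 if_False)
  then have "(\<Sum>k\<le>d. c ^ (2 * k)) = (1 - c ^ (2 * (d + 1))) / (1 - c\<^sup>2)"
    by (simp only: power_mult[symmetric] Suc_eq_plus1)
  then have "v = sqrt (\<sigma>\<^sup>2 * ((real d + 1) * (1 - 1 / 2 ^ r) +
      (1 - c ^ (2 * (d + 1))) / (1 - c ^ 2) * (c ^ (2 * d) / 2 ^ r)))"
    by (simp only: v_def)
  then have den: "sqrt 2 * v = \<sigma> * sqrt (2 * ((real d + 1) * (1 - 1 / 2 ^ r) +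
      (1 - c ^ (2 * (d + 1))) / (1 - c ^ 2) * (c ^ (2 * d) / 2 ^ r)))"
    using sigma_pos by (simp only: real_sqrt_mult real_sqrt_abs abs_of_pos mult_ac)
  have half: "xi2 p d \<sigma> c0 c1 f (class_law n) \<ge> 1 / 2" if "f \<in> decoders p d n G" for f
  proof (rule xi2_ge_half[OF n_le _ that])
    fix V W assume "V \<in> G" "W \<in> G" "\<not> close V W"
    then show "(erf c1 - erf c0) / 2 \<le> excess_risk p d \<sigma> V W"
      by (rule excess_risk_ge[OF _ _ _ c0_eq[folded den] c1_eq[folded den] v_def])
  qed
  show ?thesis
  proof
    show "G_joint_laws p d r c \<sigma> n \<subseteq> joint_laws p d n"
      by (simp add: G_joint_laws_def class_law_in_joint_laws)
    show "(INF f\<in>decoders p d n G. SUP P\<in>G_joint_laws p d r c \<sigma> n. xi2 p d \<sigma> c0 c1 f P) \<ge> 1 / 2"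
      \<comment> \<open>The family has a single member, so the supremum is its value.\<close>
      unfolding G_joint_laws_def image_insert image_empty cSup_singleton
      by (rule cINF_greatest[OF decoders_nonempty half])
  qed
qed

end
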